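(* Let $(V,M)$ and $(W,N)$ be analytic pairs and let $f:M\to N$ be a holomorphic map such that $f(V)\subset W$. Then $$E_{W,N}\bigl(f(p),df(p)(\xi)\bigr)\le E_{V,M}(p,\xi)$$ for every $p\in V$ and $\xi\in T_pV$.
   Context: An analytic pair of dimension $n$ is a pair $(V,M)$ where $M$ is a connected complex manifold of complex dimension $n$ and $V\subset M$ is a closed totally real analytic submanifold of real dimension $n$; $J$ denotes the complex structure of $TM$. $\mathcal U(V,M)$ is the class of all plurisubharmonic functions $u:M\to[0,\pi/4[$ with $u(p)=0$ for every $p\in V$. For $p\in M$, $\eta\in T_pM$, $\Gamma_M(p,\eta)$ is the set of $C^1$ maps $\gamma:\,]-\varepsilon,\varepsilon[\,\to M$ (for some $\varepsilon>0$) with $\gamma(0)=p$, $\gamma'(0)=\eta$. For $p\in V$, $\xi\in T_pV$, $u\in\mathcal U(V,M)$, $$E_{u,M}(p,\xi)=\inf_{\gamma\in\Gamma_M(p,J\xi)}\limsup_{t\to0^+}\frac{u(\gamma(t))}{t},\qquad E_{V,M}(p,\xi)=\sup_{u\in\mathcal U(V,M)}E_{u,M}(p,\xi)\in[0,+\infty].$$ *)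

theory Defs
  imports "HOL-Analysis.Analysis"
begin

section \<open>Holomorphic and real-analytic maps between coordinate spaces\<close>

definition holomorphic_vec_on ::
    "(complex^'n \<Rightarrow> complex^'m) \<Rightarrow> (complex^'n) set \<Rightarrow> bool" where
  "holomorphic_vec_on g S \<longleftrightarrow> open S \<and>
     (\<forall>z\<in>S. \<exists>L. (g has_derivative L) (at z) \<and> (\<forall>k v. L (k *s v) = k *s L v))"

text \<open>The index \<open>\<alpha>\<close> ranges over all multi-indices; the power series need not be globally convergent.\<close>

definition real_analytic_vec_on ::
    "(real^'n \<Rightarrow> complex^'m) \<Rightarrow> (real^'n) set \<Rightarrow> bool" where
  "real_analytic_vec_on g S \<longleftrightarrow> open S \<and>
     (\<forall>a\<in>S. \<exists>r>0. \<exists>coef :: ('n \<Rightarrow> nat) \<Rightarrow> complex^'m. ball a r \<subseteq> S \<and>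
        (\<forall>x\<in>ball a r.
           ((\<lambda>\<alpha>. (\<Prod>i\<in>UNIV. (x $ i - a $ i) ^ \<alpha> i) *\<^sub>R coef \<alpha>) has_sum g x) UNIV))"


section \<open>Complex manifolds\<close>

text \<open>A chart is a pair of its domain and its coordinate map; only the values of the coordinate
  map on the domain matter. The atlas need not be maximal. Manifolds are Hausdorff and second
  countable.\<close>

type_synonym ('a, 'n) chart = "'a set \<times> ('a \<Rightarrow> complex^'n)"

abbreviation chart_dom :: "('a, 'n) chart \<Rightarrow> 'a set" where "chart_dom c \<equiv> fst c"

abbreviation coords :: "('a, 'n) chart \<Rightarrow> 'a \<Rightarrow> complex^'n" where "coords c \<equiv> snd c"

abbreviation chart_inv :: "('a, 'n) chart \<Rightarrow> complex^'n \<Rightarrow> 'a" where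
  "chart_inv c \<equiv> inv_into (chart_dom c) (coords c)"

record ('a, 'n) cmanifold =
  topol :: "'a topology"
  atlas :: "('a, 'n) chart set"

abbreviation points :: "('a, 'n) cmanifold \<Rightarrow> 'a set" where
  "points M \<equiv> topspace (topol M)"

definition complex_manifold :: "('a, 'n::finite) cmanifold \<Rightarrow> bool" where
  "complex_manifold M \<longleftrightarrow>
     Hausdorff_space (topol M) \<and> second_countable (topol M) \<and>
     (\<Union>c\<in>atlas M. chart_dom c) = points M \<and>
     (\<forall>c\<in>atlas M. openin (topol M) (chart_dom c) \<and> open (coords c ` chart_dom c) \<and>
        homeomorphic_map (subtopology (topol M) (chart_dom c))
          (top_of_set (coords c ` chart_dom c)) (coords c)) \<and>
     (\<forall>c\<in>atlas M. \<forall>d\<in>atlas M.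
        holomorphic_vec_on (coords d \<circ> chart_inv c) (coords c ` (chart_dom c \<inter> chart_dom d)))"

definition charts_at :: "('a, 'n) cmanifold \<Rightarrow> 'a \<Rightarrow> ('a, 'n) chart set" where
  "charts_at M p = {c \<in> atlas M. p \<in> chart_dom c}"

definition holomorphic_mapping ::
    "('a, 'n::finite) cmanifold \<Rightarrow> ('b, 'm::finite) cmanifold \<Rightarrow> ('a \<Rightarrow> 'b) \<Rightarrow> bool" where
  "holomorphic_mapping M N f \<longleftrightarrow> continuous_map (topol M) (topol N) f \<and>
     (\<forall>c\<in>atlas M. \<forall>d\<in>atlas N.
        holomorphic_vec_on (coords d \<circ> f \<circ> chart_inv c)
          (coords c ` {x \<in> chart_dom c. f x \<in> chart_dom d}))"


section \<open>Tangent vectors\<close>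

text \<open>A tangent vector at \<open>p\<close> is the family of its coordinate vectors in all charts at \<open>p\<close>, related
  by the differentials of the coordinate changes. In charts not containing \<open>p\<close> the entry is \<open>0\<close>,
  so that vectors are determined by their coordinates and the vector space operations are
  entrywise.\<close>

type_synonym ('a, 'n) tangent = "('a, 'n) chart \<Rightarrow> complex^'n"

definition tangent_space ::
    "('a, 'n::finite) cmanifold \<Rightarrow> 'a \<Rightarrow> ('a, 'n) tangent set" where
  "tangent_space M p = {\<xi>.
     (\<forall>c. c \<notin> charts_at M p \<longrightarrow> \<xi> c = 0) \<and>
     (\<forall>c\<in>charts_at M p. \<forall>d\<in>charts_at M p.
        \<xi> d = frechet_derivative (coords d \<circ> chart_inv c) (at (coords c p)) (\<xi> c))}"

definition tangent_J :: "('a, 'n::finite) tangent \<Rightarrow> ('a, 'n) tangent" where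
  "tangent_J \<xi> = (\<lambda>c. \<i> *s \<xi> c)"

text \<open>The differential of \<open>f\<close> at \<open>p\<close>. The result does not depend on the chosen chart \<open>c\<close>.\<close>

definition tangent_map ::
    "('a, 'n::finite) cmanifold \<Rightarrow> ('b, 'm::finite) cmanifold \<Rightarrow> ('a \<Rightarrow> 'b) \<Rightarrow> 'a \<Rightarrow>
     ('a, 'n) tangent \<Rightarrow> ('b, 'm) tangent" where
  "tangent_map M N f p \<xi> =
     (let c = (SOME c. c \<in> charts_at M p) in
      (\<lambda>d. if d \<in> charts_at N (f p)
           then frechet_derivative (coords d \<circ> f \<circ> chart_inv c) (at (coords c p)) (\<xi> c)
           else 0))"


section \<open>Totally real analytic submanifolds and analytic pairs\<close>

text \<open>A local parametrization of \<open>V\<close>: a real-analytic immersion of an open subset of real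
  \<open>n\<close>-space, \<open>n\<close> being the complex dimension of \<open>M\<close>, which is a homeomorphism onto a relatively
  open subset of \<open>V\<close>.\<close>

definition local_parametrization ::
    "'a set \<Rightarrow> ('a, 'n::finite) cmanifold \<Rightarrow> (real^'n) set \<Rightarrow> (real^'n \<Rightarrow> 'a) \<Rightarrow> bool" where
  "local_parametrization V M D h \<longleftrightarrow> open D \<and>
     openin (subtopology (topol M) V) (h ` D) \<and>
     homeomorphic_map (top_of_set D) (subtopology (topol M) (h ` D)) h \<and>
     (\<forall>c\<in>atlas M. real_analytic_vec_on (coords c \<circ> h) {x \<in> D. h x \<in> chart_dom c} \<and>
        (\<forall>x\<in>D. h x \<in> chart_dom c \<longrightarrow> inj (frechet_derivative (coords c \<circ> h) (at x))))"

definition real_analytic_submanifold :: "'a set \<Rightarrow> ('a, 'n::finite) cmanifold \<Rightarrow> bool" where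
  "real_analytic_submanifold V M \<longleftrightarrow> V \<subseteq> points M \<and>
     (\<forall>p\<in>V. \<exists>D h. local_parametrization V M D h \<and> p \<in> h ` D)"

definition submanifold_tangent_space ::
    "'a set \<Rightarrow> ('a, 'n::finite) cmanifold \<Rightarrow> 'a \<Rightarrow> ('a, 'n) tangent set" where
  "submanifold_tangent_space V M p = {\<xi> \<in> tangent_space M p.
     \<exists>D h x v. local_parametrization V M D h \<and> x \<in> D \<and> h x = p \<and>
       (\<forall>c\<in>charts_at M p. \<xi> c = frechet_derivative (coords c \<circ> h) (at x) v)}"

definition totally_real :: "'a set \<Rightarrow> ('a, 'n::finite) cmanifold \<Rightarrow> bool" where
  "totally_real V M \<longleftrightarrow> (\<forall>p\<in>V.
     submanifold_tangent_space V M p \<inter> tangent_J ` submanifold_tangent_space V M p = {\<lambda>_. 0})"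

definition analytic_pair :: "'a set \<Rightarrow> ('a, 'n::finite) cmanifold \<Rightarrow> bool" where
  "analytic_pair V M \<longleftrightarrow> complex_manifold M \<and> connected_space (topol M) \<and>
     closedin (topol M) V \<and> real_analytic_submanifold V M \<and> totally_real V M"


section \<open>Plurisubharmonic functions\<close>

definition usc_map :: "'a topology \<Rightarrow> ('a \<Rightarrow> real) \<Rightarrow> bool" where
  "usc_map X u \<longleftrightarrow> (\<forall>a. openin X {x \<in> topspace X. u x < a})"

text \<open>For real-valued \<open>u\<close>, i.e. without the value \<open>-\<infinity>\<close>: the sub-mean value inequality on
  circles in complex lines whose closed discs lie in \<open>S\<close>. As \<open>u a > -\<infinity>\<close>, it comprises integrability
  of \<open>u\<close> on the circle, which is stated separately since \<open>integral\<close> is \<open>0\<close> otherwise.\<close>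

definition psh_vec_on :: "(complex^'n \<Rightarrow> real) \<Rightarrow> (complex^'n) set \<Rightarrow> bool" where
  "psh_vec_on u S \<longleftrightarrow> usc_map (top_of_set S) u \<and>
     (\<forall>a b. (\<forall>k. cmod k \<le> 1 \<longrightarrow> a + k *s b \<in> S) \<longrightarrow>
        (\<lambda>t. u (a + cis t *s b)) absolutely_integrable_on {0..2 * pi} \<and>
        u a \<le> 1 / (2 * pi) * integral {0..2 * pi} (\<lambda>t. u (a + cis t *s b)))"

definition plurisubharmonic :: "('a, 'n::finite) cmanifold \<Rightarrow> ('a \<Rightarrow> real) \<Rightarrow> bool" where
  "plurisubharmonic M u \<longleftrightarrow>
     (\<forall>c\<in>atlas M. psh_vec_on (u \<circ> chart_inv c) (coords c ` chart_dom c))"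

definition class_U :: "'a set \<Rightarrow> ('a, 'n::finite) cmanifold \<Rightarrow> ('a \<Rightarrow> real) set" where
  "class_U V M = {u. plurisubharmonic M u \<and>
     (\<forall>x\<in>points M. 0 \<le> u x \<and> u x < pi / 4) \<and> (\<forall>p\<in>V. u p = 0)}"


section \<open>The functions \<open>E\<close>\<close>

definition curves ::
    "('a, 'n::finite) cmanifold \<Rightarrow> 'a \<Rightarrow> ('a, 'n) tangent \<Rightarrow> (real \<Rightarrow> 'a) set" where
  "curves M p \<eta> = {\<gamma>. \<exists>\<epsilon>>0.
     continuous_map (top_of_set {-\<epsilon><..<\<epsilon>}) (topol M) \<gamma> \<and>
     (\<forall>c\<in>atlas M. (coords c \<circ> \<gamma>) C1_differentiable_on {t \<in> {-\<epsilon><..<\<epsilon>}. \<gamma> t \<in> chart_dom c}) \<and>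
     \<gamma> 0 = p \<and>
     (\<forall>c\<in>charts_at M p. ((coords c \<circ> \<gamma>) has_vector_derivative \<eta> c) (at 0))}"

definition function_E ::
    "('a \<Rightarrow> real) \<Rightarrow> ('a, 'n::finite) cmanifold \<Rightarrow> 'a \<Rightarrow> ('a, 'n) tangent \<Rightarrow> ereal" where
  "function_E u M p \<xi> =
     (INF \<gamma>\<in>curves M p (tangent_J \<xi>). Limsup (at_right 0) (\<lambda>t. ereal (u (\<gamma> t) / t)))"

definition pair_E ::
    "'a set \<Rightarrow> ('a, 'n::finite) cmanifold \<Rightarrow> 'a \<Rightarrow> ('a, 'n) tangent \<Rightarrow> ereal" where
  "pair_E V M p \<xi> = (SUP u\<in>class_U V M. function_E u M p \<xi>)"

end

theory Submission
  imports Defs "HOL-Complex_Analysis.Complex_Analysis"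
begin

text \<open>
  Composition with \<open>f\<close> carries the class of functions on \<open>N\<close> into that on \<open>M\<close>, and \<open>f\<close> carries the
  curves in \<open>M\<close> with velocity \<open>J \<xi>\<close> to curves in \<open>N\<close> with velocity \<open>J (df \<xi>)\<close>; so every function
  competing on \<open>N\<close> yields one on \<open>M\<close> whose infimum is taken over fewer curves.

  The analytic content is that plurisubharmonic functions pull back along holomorphic maps. No
  smoothing is used. For a holomorphic disc \<open>g\<close> and bounded plurisubharmonic \<open>u\<close>, the
  sup-convolutions \<open>u\<^sub>K z = sup\<^sub>w (u w - K |w - g z|\<^sup>2)\<close> are continuous and decrease to \<open>u \<circ> g\<close>.
  Comparing \<open>u\<close> on the affine disc \<open>l \<mapsto> w + l g' z\<close> with the penalty at \<open>z + l\<close>, the penalty is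
  \<open>|w - g z|\<^sup>2\<close> plus a harmonic function plus \<open>O(|l|\<^sup>4)\<close>, whence \<open>u\<^sub>K\<close> has the sub-mean value
  property on small circles up to \<open>O(r\<^sup>4)\<close>. Such an error does not affect the maximum principle for
  \<open>V + \<epsilon> |z|\<^sup>2\<close>, where \<open>V\<close> is the average of the rotations of the function, and this turns local
  into global sub-mean value inequalities.
\<close>

section \<open>Semicontinuity and circle averages\<close>

lemma usc_map_compose:
  assumes "usc_map X u" and "continuous_map Y X h"
  shows "usc_map Y (u \<circ> h)"
  unfolding usc_map_def
proof
  fix a
  have "openin Y {y \<in> topspace Y. h y \<in> {x \<in> topspace X. u x < a}}"
    using assms unfolding usc_map_def by (intro openin_continuous_map_preimage) auto
  moreover have "{y \<in> topspace Y. h y \<in> {x \<in> topspace X. u x < a}} = {y \<in> topspace Y. (u \<circ> h) y < a}"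
    using assms(2) by (auto simp: continuous_map_def)
  ultimately show "openin Y {y \<in> topspace Y. (u \<circ> h) y < a}" by simp
qed

lemma usc_map_borel_measurable:
  fixes h :: "'a::topological_space \<Rightarrow> 'b::topological_space"
  assumes "usc_map (top_of_set S) u" and "continuous_on UNIV h" and "range h \<subseteq> S"
  shows "(\<lambda>t. u (h t)) \<in> borel_measurable borel"
proof -
  have "usc_map euclidean (u \<circ> h)"
    using assms(2,3) by (intro usc_map_compose[OF assms(1)]) (auto simp: continuous_map_in_subtopology)
  then have "open {t. u (h t) < a}" for a
    by (simp add: usc_map_def)
  then show ?thesis
    by (intro borel_measurableI_less) simp
qed

lemma usc_map_eventually_less:
  assumes "usc_map (top_of_set S) u" and "x \<in> S" and "u x < a"
    and "(y \<longlongrightarrow> x) F" and "eventually (\<lambda>n. y n \<in> S) F"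
  shows "eventually (\<lambda>n. u (y n) < a) F"
proof -
  have "openin (top_of_set S) {x \<in> S. u x < a}"
    using assms(1) by (simp add: usc_map_def)
  then obtain T where T: "open T" "{x \<in> S. u x < a} = S \<inter> T"
    by (auto simp: openin_open)
  have "eventually (\<lambda>n. y n \<in> T) F"
    using assms T by (intro topological_tendstoD) auto
  with assms(5) show ?thesis
    by eventually_elim (use T in auto)
qed

lemma usc_map_dist_less:
  fixes x :: "'a::metric_space"
  assumes "usc_map (top_of_set S) u" and "x \<in> S" and "u x < a"
  obtains d where "0 < d" and "\<And>y. y \<in> S \<Longrightarrow> dist y x < d \<Longrightarrow> u y < a"
proof -
  have "eventually (\<lambda>y. u y < a) (at x within S)"
    using assms by (intro usc_map_eventually_less[where y = "\<lambda>y. y"])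
      (auto simp: eventually_at_topological intro: tendsto_ident_at)
  then obtain d where "0 < d" "\<And>y. y \<in> S \<Longrightarrow> y \<noteq> x \<Longrightarrow> dist y x < d \<Longrightarrow> u y < a"
    by (auto simp: eventually_at)
  with assms(3) show thesis by (metis that)
qed

section \<open>Averages over the unit circle as integrals against a probability measure\<close>

definition angle :: "real measure" where
  "angle = uniform_measure lborel {0..2 * pi}"

lemma space_angle [simp]: "space angle = UNIV"
  by (simp add: angle_def)

lemma sets_angle [measurable_cong, simp]: "sets angle = sets borel"
  by (simp add: angle_def)

lemma measure_angle [simp]: "measure angle UNIV = 1"
  by (simp add: angle_def measure_uniform_measure)

lemma finite_measure_angle: "finite_measure angle"
  by (intro finite_measureI) (simp add: angle_def emeasure_uniform_measure ennreal_divide_self)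

interpretation angle: finite_measure angle
  by (rule finite_measure_angle)

lemma integrable_angle_bounded:
  fixes h :: "real \<Rightarrow> 'b::{banach, second_countable_topology}"
  assumes "h \<in> borel_measurable borel" and "\<And>t. norm (h t) \<le> B"
  shows "integrable angle h"
  using assms by (intro angle.integrable_const_bound[where B = B]) (auto cong: measurable_cong_sets)

text \<open>\<open>psh_vec_on\<close> speaks of gauge integrals over \<open>{0..2 * pi}\<close>.
  This is the passage to Bochner integrals against \<open>angle\<close>, where Fubini, Fatou and
  dominated convergence are at hand.\<close>

lemma integral_angle_eq:
  fixes h :: "real \<Rightarrow> real"
  assumes meas [measurable]: "h \<in> borel_measurable borel" and bound: "\<And>t. norm (h t) \<le> B"
  shows "h absolutely_integrable_on {0..2 * pi}"
    and "(\<integral>t. h t \<partial>angle) = 1 / (2 * pi) * integral {0..2 * pi} h"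
proof -
  have int: "set_integrable lborel {0..2 * pi} h"
    unfolding set_integrable_def
    by (rule integrableI_bounded_set_indicator[where B = B]) (use bound in auto)
  then show "h absolutely_integrable_on {0..2 * pi}"
    unfolding set_integrable_def by (rule integrable_completion[THEN iffD2, rotated]) simp
  have "angle = density lborel (\<lambda>x. ennreal (indicator {0..2 * pi} x / (2 * pi)))"
    unfolding angle_def uniform_measure_def
    by (intro arg_cong[where f = "density lborel"] ext)
      (auto simp: indicator_def divide_ennreal[symmetric] simp flip: ennreal_1)
  then have "(\<integral>t. h t \<partial>angle) =
      (\<integral>t. h t \<partial>density lborel (\<lambda>x. ennreal (indicator {0..2 * pi} x / (2 * pi))))"
    by simp
  also have "\<dots> = (\<integral>t. (indicator {0..2 * pi} t / (2 * pi)) * h t \<partial>lborel)"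
    by (rule integral_real_density) auto
  also have "\<dots> = 1 / (2 * pi) * (\<integral>t. indicator {0..2 * pi} t *\<^sub>R h t \<partial>lborel)"
    by (subst Bochner_Integration.integral_mult_right_zero[symmetric]) (simp add: field_simps)
  also have "(\<integral>t. indicator {0..2 * pi} t *\<^sub>R h t \<partial>lborel) = integral {0..2 * pi} h"
    using set_borel_integral_eq_integral(2)[OF int] by (simp add: set_lebesgue_integral_def)
  finally show "(\<integral>t. h t \<partial>angle) = 1 / (2 * pi) * integral {0..2 * pi} h" .
qed

text \<open>Multiplication by \<open>w\<close> shifts the angle by \<open>Arg2pi w\<close>; the part
  of the shifted interval beyond \<open>2 * pi\<close> is moved back by periodicity. All conditions
  concern values on the circle, as the functions in question are controlled on a closed disc
  only.\<close>

lemma integral_angle_rotate: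
  fixes h :: "complex \<Rightarrow> real"
  assumes meas: "(\<lambda>t. h (cis t)) \<in> borel_measurable borel"
    and bound: "\<And>t. norm (h (cis t)) \<le> B" and "cmod w = 1"
  shows "(\<integral>t. h (w * cis t) \<partial>angle) = (\<integral>t. h (cis t) \<partial>angle)"
proof -
  define s where "s = Arg2pi w"
  have s: "0 \<le> s" "s < 2 * pi" and w: "w = cis s"
    using Arg2pi[of w] assms(3) by (auto simp: s_def is_Arg_def cis_conv_exp)
  define p where "p = (\<lambda>t. h (cis t))"
  have [measurable]: "p \<in> borel_measurable borel" using meas by (simp add: p_def)
  have p_bound: "norm (p t) \<le> B" for t using bound by (simp add: p_def)
  have p: "p integrable_on {a..b}" for a b
  proof -
    have "set_integrable lborel {a..b} p"
      unfolding set_integrable_def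
      by (rule integrableI_bounded_set_indicator[where B = B]) (use p_bound in \<open>auto simp: emeasure_lborel_Icc_eq\<close>)
    then show ?thesis by (rule set_borel_integral_eq_integral)
  qed
  have periodic: "p (t + 2 * pi) = p t" for t
    by (simp add: p_def flip: cis_mult)
  have "integral {0..2 * pi} (\<lambda>t. p (t + s)) = integral {s..2 * pi + s} p"
    using integral_shift_real_ivl[of s s "2 * pi + s" p] by simp
  also have "\<dots> = integral {s..2 * pi} p + integral {2 * pi..2 * pi + s} p"
    using s p by (intro Henstock_Kurzweil_Integration.integral_combine[symmetric]) auto
  also have "integral {2 * pi..2 * pi + s} p = integral {0..s} p"
    using integral_shift_real_ivl[of "2 * pi" "2 * pi" "2 * pi + s" p] by (simp add: periodic)
  also have "integral {s..2 * pi} p + integral {0..s} p = integral {0..2 * pi} p"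
    using s p Henstock_Kurzweil_Integration.integral_combine[of 0 s "2 * pi" p] by auto
  finally have "integral {0..2 * pi} (\<lambda>t. p (t + s)) = integral {0..2 * pi} p" .
  moreover have "(\<integral>t. p (t + s) \<partial>angle) = 1 / (2 * pi) * integral {0..2 * pi} (\<lambda>t. p (t + s))"
    by (rule integral_angle_eq[where B = B]) (use p_bound in measurable)
  moreover have "(\<integral>t. p t \<partial>angle) = 1 / (2 * pi) * integral {0..2 * pi} p"
    by (rule integral_angle_eq[where B = B]) (use p_bound in measurable)
  ultimately show ?thesis
    by (simp add: p_def w cis_mult add.commute)
qed

text \<open>Cauchy's integral formula at the centre: along the circle, \<open>du / u\<close> becomes
  \<open>\<i> dt\<close>. It serves to make the harmonic terms of an estimate vanish.\<close>

lemma integral_angle_Re_holomorphic: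
  assumes cont: "continuous_on (cball 0 1) q" and hol: "q holomorphic_on ball 0 1"
  shows "(\<integral>t. Re (q (cis t)) \<partial>angle) = Re (q 0)"
proof -
  have "((\<lambda>u. q u / (u - 0)) has_contour_integral 2 * of_real pi * \<i> * q 0) (circlepath 0 1)"
    by (rule Cauchy_integral_circlepath[OF cont hol]) simp
  then have "((\<lambda>t. q (cis t) * \<i>) has_integral 2 * of_real pi * \<i> * q 0) {0..2 * pi}"
    unfolding circlepath_def by (subst (asm) has_contour_integral_part_circlepath_iff) auto
  from has_integral_mult_right[OF this, of "-\<i>"]
  have "((\<lambda>t. q (cis t)) has_integral 2 * of_real pi * q 0) {0..2 * pi}"
    by (simp add: mult_ac)
  from has_integral_Re[OF this] have I: "integral {0..2 * pi} (\<lambda>t. Re (q (cis t))) = 2 * pi * Re (q 0)"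
    by (simp add: integral_unique)
  have c: "continuous_on UNIV (\<lambda>t. q (cis t))"
    by (rule continuous_on_compose2[OF cont]) (auto intro!: continuous_intros)
  have "bounded (q ` cball 0 1)"
    by (intro compact_imp_bounded compact_continuous_image cont) auto
  then obtain B where B: "\<And>z. z \<in> cball 0 1 \<Longrightarrow> norm (q z) \<le> B"
    unfolding bounded_iff by blast
  have "norm (Re (q (cis t))) \<le> B" for t
    using abs_Re_le_cmod[of "q (cis t)"] B[of "cis t"] by auto
  moreover have "(\<lambda>t. Re (q (cis t))) \<in> borel_measurable borel"
    by (intro borel_measurable_continuous_onI continuous_intros c)
  ultimately have "(\<integral>t. Re (q (cis t)) \<partial>angle) = 1 / (2 * pi) * integral {0..2 * pi} (\<lambda>t. Re (q (cis t)))"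
    by (intro integral_angle_eq[where B = B]) auto
  with I show ?thesis by simp
qed

section \<open>From local to global sub-mean value inequalities\<close>

text \<open>The cross term of the square is the real part of a linear function and averages to 0.
  The gain \<open>r\<^sup>2\<close> over the value at the centre is what beats errors of order
  \<open>r ^ 4\<close> in \<open>circle_submean\<close>.\<close>

lemma integral_angle_norm_circle:
  "(\<integral>t. (cmod (z + of_real r * cis t))\<^sup>2 \<partial>angle) = (cmod z)\<^sup>2 + r\<^sup>2"
proof -
  have cos0: "(\<integral>t. Re (2 * of_real r * cnj z * cis t) \<partial>angle) = 0"
    by (subst integral_angle_Re_holomorphic[where q = "\<lambda>w. 2 * of_real r * cnj z * w"])
      (auto intro!: continuous_intros holomorphic_intros)
  have int: "integrable angle (\<lambda>t. Re (2 * of_real r * cnj z * cis t))"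
  proof (rule integrable_angle_bounded)
    show "norm (Re (2 * of_real r * cnj z * cis t)) \<le> cmod (2 * of_real r * cnj z)" for t
      using abs_Re_le_cmod[of "2 * of_real r * cnj z * cis t"] by (simp add: norm_mult)
  qed (intro borel_measurable_continuous_onI continuous_intros)
  have "(cmod (z + of_real r * cis t))\<^sup>2 = ((cmod z)\<^sup>2 + r\<^sup>2) + Re (2 * of_real r * cnj z * cis t)" for t
    unfolding cmod_power2 using sin_cos_squared_add[of t]
    by (simp add: power2_eq_square) algebra
  then show ?thesis
    using int cos0 by simp
qed

text \<open>A maximum principle for \<open>v\<close> itself would bound \<open>v 0\<close> by the
  maximum over the circle. Averaging over rotations keeps the value at 0 and makes the boundary
  values constant, equal to the mean, so that for the averaged function the same principle gives the
  mean.\<close>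

lemma circle_submean:
  fixes v :: "complex \<Rightarrow> real"
  assumes usc: "usc_map (top_of_set (cball 0 1)) v"
    and bound: "\<And>z. cmod z \<le> 1 \<Longrightarrow> 0 \<le> v z \<and> v z \<le> 1"
    and local: "\<And>\<rho>. 0 < \<rho> \<Longrightarrow> \<rho> < 1 \<Longrightarrow> \<exists>\<delta>>0. \<exists>C. \<forall>z r. cmod z \<le> \<rho> \<and> 0 < r \<and> r < \<delta> \<longrightarrow>
      v z \<le> (\<integral>t. v (z + of_real r * cis t) \<partial>angle) + C * r ^ 4"
  shows "v 0 \<le> (\<integral>t. v (cis t) \<partial>angle)"
proof -
  define V where "V = (\<lambda>z. \<integral>t. v (cis t * z) \<partial>angle)"
  have meas: "(\<lambda>t. v (h t)) \<in> borel_measurable borel"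
    if "continuous_on UNIV h" "\<And>t. cmod (h t) \<le> 1" for h :: "'a::topological_space \<Rightarrow> complex"
    using that by (intro usc_map_borel_measurable[OF usc]) auto
  have int: "integrable angle (\<lambda>t. v (h t))"
    if "continuous_on UNIV h" "\<And>t. cmod (h t) \<le> 1" for h
    using that bound by (intro integrable_angle_bounded[where B = 1] meas) auto
  have circ: "cmod (cis t * z + of_real r * cis s) \<le> 1" if "cmod z + r \<le> 1" "0 \<le> r" for t z r s
    using norm_triangle_ineq[of "cis t * z" "of_real r * cis s"] that by (simp add: norm_mult)
  have intV: "integrable angle (\<lambda>t. v (cis t * z))" if "cmod z \<le> 1" for z
    using that by (intro int continuous_intros) (auto simp: norm_mult)
  have V_bound: "0 \<le> V z \<and> V z \<le> 1" if "cmod z \<le> 1" for z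
  proof
    show "0 \<le> V z"
      unfolding V_def using that bound by (intro Bochner_Integration.integral_nonneg) (auto simp: norm_mult)
    have "V z \<le> (\<integral>t. 1 \<partial>angle)"
      unfolding V_def using that bound by (intro integral_mono intV) (auto simp: norm_mult)
    then show "V z \<le> 1" by simp
  qed
  have V_0: "V 0 = v 0" by (simp add: V_def)
  have V_1: "V z = (\<integral>t. v (cis t) \<partial>angle)" if "cmod z = 1" for z
  proof -
    have "(\<integral>t. v (z * cis t) \<partial>angle) = (\<integral>t. v (cis t) \<partial>angle)"
      using that bound by (intro integral_angle_rotate[where B = 1] meas continuous_intros) auto
    then show ?thesis by (simp add: V_def mult.commute)
  qed
  \<comment> \<open>Upper semicontinuity of \<open>V\<close> along sequences: Fatou's lemma for the
    nonnegative functions \<open>1 - v\<close>. The lower bounds \<open>b n\<close> stand in for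
    \<open>V (x n)\<close>, which need not converge.\<close>
  have V_limit: "a \<le> V z"
    if z: "x \<longlonglongrightarrow> z" "\<And>n. cmod (x n) \<le> 1" and a: "b \<longlonglongrightarrow> a" "\<And>n. b n \<le> V (x n)" for x z a b
  proof -
    have z1: "cmod z \<le> 1"
      using z by (intro LIMSEQ_le_const2[OF tendsto_norm[OF z(1)]]) auto
    have nn: "(\<integral>\<^sup>+ t. ennreal (1 - v (cis t * w)) \<partial>angle) = ennreal (1 - V w)" if "cmod w \<le> 1" for w
      using that bound by (subst nn_integral_eq_integral) (auto simp: V_def norm_mult intV)
    have [measurable]: "(\<lambda>t. v (cis t * x n)) \<in> borel_measurable borel" for n
      using z by (intro meas continuous_intros) (auto simp: norm_mult)
    have "ennreal (1 - v (cis t * z)) \<le> liminf (\<lambda>n. ennreal (1 - v (cis t * x n)))" for t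
      unfolding le_Liminf_iff
    proof (intro allI impI)
      fix y assume y: "y < ennreal (1 - v (cis t * z))"
      then obtain y' where y': "y = ennreal y'" "0 \<le> y'"
        by (cases y) auto
      with y have "v (cis t * z) < 1 - y'" by (auto simp: ennreal_less_iff)
      then have "eventually (\<lambda>n. v (cis t * x n) < 1 - y') sequentially"
        using z z1 by (intro usc_map_eventually_less[OF usc]) (auto intro!: tendsto_intros simp: norm_mult)
      then show "eventually (\<lambda>n. y < ennreal (1 - v (cis t * x n))) sequentially"
        by eventually_elim (use y' in \<open>auto simp: ennreal_less_iff\<close>)
    qed
    then have "ennreal (1 - V z) \<le> (\<integral>\<^sup>+ t. liminf (\<lambda>n. ennreal (1 - v (cis t * x n))) \<partial>angle)"
      by (subst nn[OF z1, symmetric]) (auto intro!: nn_integral_mono)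
    also have "\<dots> \<le> liminf (\<lambda>n. \<integral>\<^sup>+ t. ennreal (1 - v (cis t * x n)) \<partial>angle)"
      by (rule nn_integral_liminf) measurable
    also have "\<dots> \<le> liminf (\<lambda>n. ennreal (1 - b n))"
      using z a by (intro Liminf_mono always_eventually) (auto simp: nn intro!: ennreal_leI)
    also have "\<dots> = ennreal (1 - a)"
      by (intro lim_imp_Liminf tendsto_ennrealI tendsto_intros a) auto
    finally show "a \<le> V z"
    proof -
      assume *: "ennreal (1 - V z) \<le> ennreal (1 - a)"
      \<comment> \<open>\<open>ennreal\<close> sends negative reals to 0, so the inequality can be
        read back in the reals only once \<open>1 - a\<close> is known to be nonnegative.\<close>
      have "a \<le> 1"
        using a V_bound z by (intro LIMSEQ_le_const2[OF a(1)]) (meson order_trans)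
      with * show ?thesis by (simp add: ennreal_le_iff)
    qed
  qed
  \<comment> \<open>The inequalities at the points \<open>cis t * z\<close> are averaged over
    \<open>t\<close>. Turning each small circle by \<open>cis t\<close> makes it the rotated image
    of the circle about \<open>z\<close>, after which Fubini exchanges the two averages.\<close>
  have V_local: "V z \<le> (\<integral>s. V (z + of_real r * cis s) \<partial>angle) + C * r ^ 4"
    if zr: "cmod z + r \<le> 1" "0 < r"
      and le: "\<And>t. v (cis t * z) \<le> (\<integral>s. v (cis t * z + of_real r * cis s) \<partial>angle) + C * r ^ 4"
    for z r C
  proof -
    interpret P: pair_sigma_finite angle angle ..
    define f where "f = (\<lambda>t s. v (cis t * (z + of_real r * cis s)))"
    have zr1: "cmod (cis t * (z + of_real r * cis s)) \<le> 1" for t s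
      using norm_triangle_ineq[of z "of_real r * cis s"] zr by (simp add: norm_mult)
    have "(\<lambda>p. v (cis (fst p) * (z + of_real r * cis (snd p)))) \<in> borel_measurable borel"
      using zr1 by (intro meas continuous_intros) auto
    then have f_meas: "case_prod f \<in> borel_measurable (angle \<Otimes>\<^sub>M angle)"
      unfolding f_def case_prod_beta
      by (subst measurable_cong_sets[OF sets_pair_measure_cong[OF sets_angle sets_angle] refl])
        (simp add: borel_prod)
    interpret PF: finite_measure "angle \<Otimes>\<^sub>M angle"
      by (rule finite_measure_pair_measure) (rule finite_measure_angle)+
    have f_int: "integrable (angle \<Otimes>\<^sub>M angle) (case_prod f)"
      using zr1 bound by (intro PF.integrable_const_bound[where B = 1] f_meas) (auto simp: f_def)
    have inner: "(\<integral>s. v (cis t * z + of_real r * cis s) \<partial>angle) = (\<integral>s. f t s \<partial>angle)" for t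
    proof -
      have "(\<integral>s. v (cis t * z + of_real r * (cis t * cis s)) \<partial>angle)
          = (\<integral>s. v (cis t * z + of_real r * cis s) \<partial>angle)"
        using circ[of z r] zr bound
        by (intro integral_angle_rotate[where h = "\<lambda>w. v (cis t * z + of_real r * w)" and B = 1] meas continuous_intros)
          (auto simp: norm_mult)
      then show ?thesis by (simp add: f_def algebra_simps)
    qed
    have "V z \<le> (\<integral>t. (\<integral>s. f t s \<partial>angle) + C * r ^ 4 \<partial>angle)"
      unfolding V_def using le zr P.integrable_fst'[OF f_int]
      by (intro integral_mono intV) (auto simp: inner)
    also have "\<dots> = (\<integral>t. (\<integral>s. f t s \<partial>angle) \<partial>angle) + C * r ^ 4"
      using P.integrable_fst'[OF f_int] by simp
    also have "(\<integral>t. (\<integral>s. f t s \<partial>angle) \<partial>angle) = (\<integral>s. (\<integral>t. f t s \<partial>angle) \<partial>angle)"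
      by (rule P.Fubini_integral[OF f_int, symmetric])
    finally show ?thesis by (simp add: V_def f_def)
  qed
  have main: "v 0 \<le> (\<integral>t. v (cis t) \<partial>angle) + \<epsilon>" if "0 < \<epsilon>" for \<epsilon>
  proof -
    define F where "F = (\<lambda>z. V z + \<epsilon> * (cmod z)\<^sup>2)"
    have F_le: "F z \<le> 1 + \<epsilon>" if "cmod z \<le> 1" for z
      using V_bound[OF that] \<open>0 < \<epsilon>\<close> that by (auto simp: F_def power_le_one intro!: add_mono mult_left_le)
    define S where "S = (SUP z\<in>cball 0 1. F z)"
    have bdd: "bdd_above (F ` cball 0 1)" using F_le by (auto intro!: bdd_aboveI)
    \<comment> \<open>The supremum is attained although \<open>F\<close> is only upper
      semicontinuous: a maximising sequence has a convergent subsequence, to which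
      \<open>V_limit\<close> applies.\<close>
    have "\<exists>x\<in>cball 0 1. S - 1 / Suc n < F x" for n
      unfolding S_def using bdd less_cSUP_iff[of "cball (0::complex) 1" F "(SUP z\<in>cball 0 1. F z) - 1 / Suc n"]
      by auto
    then obtain x where x: "\<And>n. x n \<in> cball 0 1" "\<And>n. S - 1 / Suc n < F (x n)" by metis
    obtain z0 g where z0: "z0 \<in> cball 0 1" "strict_mono (g :: nat \<Rightarrow> nat)" "(x \<circ> g) \<longlonglongrightarrow> z0"
      using compact_cball[of "0::complex" 1] x(1) unfolding compact_def by metis
    have "(\<lambda>n. S - 1 / Suc n) \<longlonglongrightarrow> S - 0"
      by (intro tendsto_intros LIMSEQ_Suc[OF lim_1_over_n])
    from LIMSEQ_subseq_LIMSEQ[OF this z0(2)]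
    have lim0: "(\<lambda>n. S - 1 / Suc (g n)) \<longlonglongrightarrow> S - 0" by (simp only: o_def)
    have lim: "(\<lambda>n. (S - 1 / Suc (g n)) - \<epsilon> * (cmod (x (g n)))\<^sup>2) \<longlonglongrightarrow> (S - 0) - \<epsilon> * (cmod z0)\<^sup>2"
      using z0(3) unfolding o_def by (intro tendsto_diff[OF lim0] tendsto_intros)
    have "(S - 0) - \<epsilon> * (cmod z0)\<^sup>2 \<le> V z0"
    proof (rule V_limit[OF z0(3) _ lim])
      show "cmod ((x \<circ> g) n) \<le> 1" for n using x(1)[of "g n"] by simp
      show "S - 1 / real (Suc (g n)) - \<epsilon> * (cmod (x (g n)))\<^sup>2 \<le> V ((x \<circ> g) n)" for n
        using x(2)[of "g n"] by (simp add: F_def)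
    qed
    then have max: "F z \<le> F z0" if "cmod z \<le> 1" for z
      using cSUP_upper[OF _ bdd, of z] that by (auto simp: F_def S_def)
    have "cmod z0 = 1"
    proof (rule ccontr)
      assume "cmod z0 \<noteq> 1"
      with z0 have z01: "cmod z0 < 1" by simp
      define \<rho> where "\<rho> = (1 + cmod z0) / 2"
      have \<rho>: "0 < \<rho>" "\<rho> < 1" "cmod z0 \<le> \<rho>" using z01 by (auto simp: \<rho>_def add_pos_nonneg)
      obtain \<delta> C where \<delta>: "\<delta> > 0" "\<And>z r. cmod z \<le> \<rho> \<Longrightarrow> 0 < r \<Longrightarrow> r < \<delta> \<Longrightarrow>
          v z \<le> (\<integral>t. v (z + of_real r * cis t) \<partial>angle) + C * r ^ 4"
        using local[OF \<rho>(1,2)] by blast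
      \<comment> \<open>The radius must keep the circle inside the disc, be admissible for the local
        inequality, and make the error \<open>C * r ^ 4\<close> smaller than the gain
        \<open>\<epsilon> * r\<^sup>2\<close>.\<close>
      have "eventually (\<lambda>r. C * r\<^sup>2 < \<epsilon>) (at_right 0)"
        using \<open>0 < \<epsilon>\<close> by (intro order_tendstoD(2)[where y = "C * 0\<^sup>2"] tendsto_intros) auto
      moreover have "eventually (\<lambda>r. r < min \<delta> (1 - cmod z0)) (at_right 0)"
        using \<delta>(1) z01 by (intro order_tendstoD(2)[OF tendsto_ident_at]) auto
      ultimately have "eventually (\<lambda>r. C * r\<^sup>2 < \<epsilon> \<and> r < \<delta> \<and> r < 1 - cmod z0 \<and> 0 < r) (at_right 0)"
        using eventually_at_right_less[of 0] by eventually_elim auto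
      then obtain r where r: "C * r\<^sup>2 < \<epsilon>" "r < \<delta>" "r < 1 - cmod z0" "0 < r"
        using eventually_happens' trivial_limit_at_right_real by blast
      have zr1: "cmod (z0 + of_real r * cis s) \<le> 1" for s
        using norm_triangle_ineq[of z0 "of_real r * cis s"] r by (simp add: norm_mult)
      have V1: "V z0 \<le> (\<integral>s. V (z0 + of_real r * cis s) \<partial>angle) + C * r ^ 4"
        using \<delta>(2)[of "cis t * z0" r for t] r \<rho> by (intro V_local) (auto simp: norm_mult)
      have "(\<integral>s. V (z0 + of_real r * cis s) \<partial>angle)
          \<le> (\<integral>s. F z0 - \<epsilon> * (cmod (z0 + of_real r * cis s))\<^sup>2 \<partial>angle)"
      \<comment> \<open>Integrability is shown for the majorant only. In return the majorant has to
        be nonnegative, as the integral of a nonintegrable function is 0 by default.\<close>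
      proof (rule integral_mono')
        show "integrable angle (\<lambda>s. F z0 - \<epsilon> * (cmod (z0 + of_real r * cis s))\<^sup>2)"
        proof (rule integrable_angle_bounded)
          show "norm (F z0 - \<epsilon> * (cmod (z0 + of_real r * cis s))\<^sup>2) \<le> \<bar>F z0\<bar> + \<epsilon> * 1" for s
            using zr1[of s] \<open>0 < \<epsilon>\<close> power_le_one[OF norm_ge_zero zr1[of s], of 2]
            by (intro order_trans[OF norm_triangle_ineq4] add_mono) (auto simp: abs_mult mult_left_le)
        qed (intro borel_measurable_continuous_onI continuous_intros)
        show "V (z0 + of_real r * cis s) \<le> F z0 - \<epsilon> * (cmod (z0 + of_real r * cis s))\<^sup>2" for s
          using max[OF zr1[of s]] by (simp add: F_def)
        then show "0 \<le> F z0 - \<epsilon> * (cmod (z0 + of_real r * cis s))\<^sup>2" for s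
          using V_bound[OF zr1[of s]] by (meson order_trans)
      qed
      also have "\<dots> = F z0 - \<epsilon> * ((cmod z0)\<^sup>2 + r\<^sup>2)"
      proof -
        have "integrable angle (\<lambda>s. (cmod (z0 + of_real r * cis s))\<^sup>2)"
          by (rule integrable_angle_bounded[where B = 1])
            (use zr1 in \<open>auto intro!: borel_measurable_continuous_onI continuous_intros simp: power_le_one\<close>)
        then show ?thesis by (simp add: integral_angle_norm_circle)
      qed
      finally have "\<epsilon> * r\<^sup>2 \<le> C * r ^ 4"
        using V1 by (simp add: F_def algebra_simps)
      also have "\<dots> = (C * r\<^sup>2) * r\<^sup>2" by (simp add: power_numeral_reduce)
      also have "\<dots> < \<epsilon> * r\<^sup>2" using r by (intro mult_strict_right_mono) auto
      finally show False by simp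
    qed
    \<comment> \<open>On the boundary \<open>V\<close> is the circle mean and the perturbation is
      exactly \<open>\<epsilon>\<close>; at 0 the perturbation vanishes.\<close>
    then have "F z0 = (\<integral>t. v (cis t) \<partial>angle) + \<epsilon>" by (simp add: F_def V_1)
    moreover have "F 0 = v 0" by (simp add: F_def V_0)
    ultimately show ?thesis using max[of 0] by simp
  qed
  then show ?thesis by (rule field_le_epsilon)
qed

section \<open>Plurisubharmonic functions on holomorphic discs\<close>

lemma continuous_on_imp_usc_map:
  assumes "continuous_on S u"
  shows "usc_map (top_of_set S) u"
  unfolding usc_map_def
proof
  fix a
  have "openin (top_of_set S) (S \<inter> u -` {..<a})"
    using assms by (intro continuous_openin_preimage_gen) auto
  then show "openin (top_of_set S) {x \<in> topspace (top_of_set S). u x < a}"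
    by (simp add: vimage_def Int_def)
qed

lemma integrable_angle_continuous:
  fixes F :: "complex \<Rightarrow> real"
  assumes "continuous_on (cball 0 1) F"
  shows "integrable angle (\<lambda>t. F (cis t))"
proof -
  have "bounded (F ` cball 0 1)"
    by (intro compact_imp_bounded compact_continuous_image assms) auto
  then obtain B where "\<And>z. z \<in> cball 0 1 \<Longrightarrow> norm (F z) \<le> B"
    unfolding bounded_iff by blast
  moreover have "continuous_on UNIV (\<lambda>t. F (cis t))"
    by (rule continuous_on_compose2[OF assms]) (auto intro!: continuous_intros)
  ultimately show ?thesis
    by (intro integrable_angle_bounded[where B = B] borel_measurable_continuous_onI) auto
qed

section \<open>Hermitian norms and complex scaling on coordinate space\<close>

lemma norm_vec_power2: "(norm (x :: complex^'n))\<^sup>2 = (\<Sum>i\<in>UNIV. (cmod (x $ i))\<^sup>2)"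
  by (simp add: norm_vec_def L2_set_def sum_nonneg)

lemma norm_vector_scalar_mult: "norm (k *s (x :: complex^'n)) = cmod k * norm x"
proof (rule power2_eq_imp_eq)
  show "(norm (k *s x))\<^sup>2 = (cmod k * norm x)\<^sup>2"
    by (simp add: norm_vec_power2 power_mult_distrib norm_mult sum_distrib_left)
qed auto

lemma continuous_on_vector_scalar_mult [continuous_intros]:
  fixes g :: "'a::topological_space \<Rightarrow> complex^'n"
  assumes "continuous_on S k" and "continuous_on S g"
  shows "continuous_on S (\<lambda>x. k x *s g x)"
  unfolding vector_scalar_mult_def
  by (intro continuous_on_vec_lambda continuous_intros assms)

text \<open>The conjugate is put on \<open>a\<close> so that, for fixed \<open>a\<close> and
  holomorphic \<open>b\<close>, the cross term is the real part of a holomorphic function.\<close>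

lemma cmod_diff_power2: "(cmod (a - b))\<^sup>2 = (cmod a)\<^sup>2 - 2 * Re (cnj a * b) + (cmod b)\<^sup>2"
  unfolding cmod_power2 by (simp add: power2_eq_square algebra_simps)

text \<open>The factor 3 leaves room for the affine discs: \<open>g z\<close> is within
  \<open>\<rho>\<close> of \<open>w0\<close>, the relevant points \<open>w\<close> are within
  \<open>\<rho>\<close> of \<open>g z\<close>, and the discs about \<open>w\<close> have radius at
  most \<open>\<rho>\<close>.\<close>

lemma submean_compose:
  fixes u :: "complex^'m::finite \<Rightarrow> real" and g :: "complex \<Rightarrow> complex^'m"
  assumes psh: "psh_vec_on u S" and bound: "\<And>w. w \<in> S \<Longrightarrow> 0 \<le> u w \<and> u w \<le> 1"
    and T: "open T" "cball 0 1 \<subseteq> T" and hol: "\<And>i. (\<lambda>z. g z $ i) holomorphic_on T"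
    and g: "g ` cball 0 1 \<subseteq> cball w0 \<rho>" and \<rho>: "0 < \<rho>" "cball w0 (3 * \<rho>) \<subseteq> S"
  shows "u (g 0) \<le> (\<integral>t. u (g (cis t)) \<partial>angle)"
proof -
  define U where "U = cball w0 (3 * \<rho>)"
  have US: "U \<subseteq> S" using \<rho> by (simp add: U_def)
  have usc: "usc_map (top_of_set S) u" using psh by (simp add: psh_vec_on_def)
  have hol_cont: "continuous_on (cball 0 1) h" if "h holomorphic_on T" for h
    using holomorphic_on_imp_continuous_on[OF that] T(2) by (rule continuous_on_subset)
  have "continuous_on (cball 0 1) (\<lambda>z. \<chi> i. g z $ i)"
    by (intro continuous_on_vec_lambda hol_cont hol)
  then have g_cont: "continuous_on (cball 0 1) g" by simp
  have g_dist: "dist w0 (g z) \<le> \<rho>" if "cmod z \<le> 1" for z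
    using g that by force
  have gU: "g z \<in> U" if "cmod z \<le> 1" for z
    using g_dist[OF that] \<rho> by (simp add: U_def)
  \<comment> \<open>The point \<open>z\<close> enters through the penalty alone, so
    \<open>uK K\<close> is continuous although \<open>u\<close> is merely upper
    semicontinuous.\<close>
  define uK where "uK = (\<lambda>K z. SUP w\<in>U. u w - K * (dist w (g z))\<^sup>2)"
  have bdd: "bdd_above ((\<lambda>w. u w - K * (dist w (g z))\<^sup>2) ` U)" if "0 \<le> K" for K z
  proof (rule bdd_aboveI2)
    fix w assume "w \<in> U"
    then have "u w \<le> 1" using bound US by auto
    moreover have "0 \<le> K * (dist w (g z))\<^sup>2" using that by simp
    ultimately show "u w - K * (dist w (g z))\<^sup>2 \<le> 1" by linarith
  qed
  have uK_upper: "u w - K * (dist w (g z))\<^sup>2 \<le> uK K z" if "0 \<le> K" "w \<in> U" for K z w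
    unfolding uK_def by (intro cSUP_upper bdd that)
  have uK_least: "uK K z \<le> c" if "\<And>w. w \<in> U \<Longrightarrow> u w - K * (dist w (g z))\<^sup>2 \<le> c" for K z c
    unfolding uK_def using \<rho>(1) that by (intro cSUP_least) (auto simp: U_def)
  have uK_ge: "u (g z) \<le> uK K z" if "0 \<le> K" "cmod z \<le> 1" for K z
    using uK_upper[OF that(1) gU[OF that(2)], of z] by simp
  have uK_bound: "0 \<le> uK K z \<and> uK K z \<le> 1" if "0 \<le> K" "cmod z \<le> 1" for K z
  proof
    show "0 \<le> uK K z" using uK_ge[OF that] bound gU[OF that(2)] US by (meson order_trans subsetD)
    show "uK K z \<le> 1"
    proof (rule uK_least)
      fix w assume "w \<in> U"
      then have "u w \<le> 1" using bound US by auto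
      moreover have "0 \<le> K * (dist w (g z))\<^sup>2" using that by simp
      ultimately show "u w - K * (dist w (g z))\<^sup>2 \<le> 1" by linarith
    qed
  qed
  have uK_lipschitz: "uK K z \<le> uK K z' + K * (8 * \<rho>) * dist (g z') (g z)"
    if "0 \<le> K" "cmod z \<le> 1" "cmod z' \<le> 1" for K z z'
  proof (rule uK_least)
    fix w assume w: "w \<in> U"
    \<comment> \<open>The sum of the radii \<open>3 * \<rho>\<close> of \<open>U\<close> and
      \<open>\<rho>\<close> of the image of \<open>g\<close>; two such distances give the constant
      \<open>8 * \<rho>\<close>.\<close>
    have d: "dist w (g y) \<le> 4 * \<rho>" if "cmod y \<le> 1" for y
      using w g_dist[OF that] dist_triangle[of w "g y" w0] by (simp add: U_def dist_commute)
    have "(dist w (g z'))\<^sup>2 - (dist w (g z))\<^sup>2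
        = (dist w (g z') + dist w (g z)) * (dist w (g z') - dist w (g z))"
      by (simp add: power2_eq_square algebra_simps)
    also have "\<dots> \<le> (dist w (g z') + dist w (g z)) * dist (g z') (g z)"
      using dist_triangle[of w "g z'" "g z"] by (intro mult_left_mono) (auto simp: dist_commute)
    also have "\<dots> \<le> (8 * \<rho>) * dist (g z') (g z)"
      using d[of z] d[of z'] that by (intro mult_right_mono) auto
    finally have "K * ((dist w (g z'))\<^sup>2 - (dist w (g z))\<^sup>2) \<le> K * ((8 * \<rho>) * dist (g z') (g z))"
      using that by (intro mult_left_mono)
    then show "u w - K * (dist w (g z))\<^sup>2 \<le> uK K z' + K * (8 * \<rho>) * dist (g z') (g z)"
      using uK_upper[OF that(1) w, of z'] by (simp add: algebra_simps)
  qed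
  have uK_cont: "continuous_on (cball 0 1) (uK K)" if K: "0 \<le> K" for K
    unfolding continuous_on_def
  proof
    fix z :: complex assume z: "z \<in> cball 0 1"
    have "((\<lambda>y. K * (8 * \<rho>) * dist (g y) (g z)) \<longlongrightarrow> K * (8 * \<rho>) * dist (g z) (g z)) (at z within cball 0 1)"
      using g_cont z by (intro tendsto_intros) (auto simp: continuous_on_def)
    then have lim: "((\<lambda>y. K * (8 * \<rho>) * dist (g y) (g z)) \<longlongrightarrow> 0) (at z within cball 0 1)" by simp
    have "eventually (\<lambda>y. y \<in> cball 0 1) (at z within cball 0 1)"
      by (simp add: eventually_at_filter)
    then have "eventually (\<lambda>y. norm (uK K y - uK K z) \<le> K * (8 * \<rho>) * dist (g y) (g z)) (at z within cball 0 1)"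
    proof eventually_elim
      case (elim y)
      then show ?case
        using uK_lipschitz[OF K, of y z] uK_lipschitz[OF K, of z y] z by (auto simp: dist_commute abs_le_iff)
    qed
    from Lim_null_comparison[OF this lim] show "(uK K \<longlongrightarrow> uK K z) (at z within cball 0 1)"
      by (rule LIM_zero_cancel)
  qed
  define gp where "gp = (\<lambda>z. \<chi> i. deriv (\<lambda>z. g z $ i) z)"
  have hol': "deriv (\<lambda>z. g z $ i) holomorphic_on T" "deriv (deriv (\<lambda>z. g z $ i)) holomorphic_on T" for i
    by (intro holomorphic_deriv hol T)+
  have "\<exists>B. \<forall>z\<in>cball 0 1. cmod (h z) \<le> B" if "h holomorphic_on T" for h
  proof -
    have "bounded (h ` cball 0 1)"
      by (intro compact_imp_bounded compact_continuous_image hol_cont that) auto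
    then show ?thesis unfolding bounded_iff by blast
  qed
  then have "\<forall>i. \<exists>B. \<forall>z\<in>cball 0 1. cmod (deriv (deriv (\<lambda>z. g z $ i)) z) \<le> B"
    using hol' by blast
  then obtain B where B: "\<And>i z. z \<in> cball 0 1 \<Longrightarrow> cmod (deriv (deriv (\<lambda>z. g z $ i)) z) \<le> B i"
    by metis
  have "continuous_on (cball 0 1) gp"
    unfolding gp_def
    by (intro continuous_on_vec_lambda hol_cont hol')
  then have "bounded (gp ` cball 0 1)"
    by (intro compact_imp_bounded compact_continuous_image) auto
  then obtain B' where B': "\<And>z. z \<in> cball 0 1 \<Longrightarrow> norm (gp z) \<le> B'"
    unfolding bounded_iff by blast
  have B'0: "0 \<le> B'" using order_trans[OF norm_ge_zero B'[of 0]] by simp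
  define C where "C = (\<Sum>i\<in>UNIV. (B i)\<^sup>2)"
  \<comment> \<open>The first-order Taylor remainder. It is holomorphic in \<open>l\<close>,
    vanishes at \<open>l = 0\<close>, and its squared norm is of order 4.\<close>
  define R where "R = (\<lambda>z l. g (z + l) - g z - l *s gp z)"
  have Taylor: "(norm (R z l))\<^sup>2 \<le> C * (cmod l) ^ 4" if "cmod z \<le> 1" "cmod (z + l) \<le> 1" for z l
  proof -
    have "cmod (R z l $ i) \<le> B i * (cmod l)\<^sup>2" for i
    proof -
      define f where "f = (\<lambda>k. (deriv ^^ k) (\<lambda>z. g z $ i))"
      have "cmod (f 0 (z + l) - (\<Sum>k\<le>1. f k z * ((z + l) - z) ^ k / fact k)) \<le> B i * cmod ((z + l) - z) ^ Suc 1 / fact 1"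
      proof (rule complex_Taylor[where S = "cball 0 1"])
        fix k :: nat and x :: complex assume "x \<in> cball 0 1"
        then have "x \<in> T" using T by auto
        moreover have "f k holomorphic_on T"
          unfolding f_def using hol T by (intro holomorphic_higher_deriv)
        ultimately show "(f k has_field_derivative f (Suc k) x) (at x within cball 0 1)"
          using T(1) unfolding f_def funpow.simps o_apply
          by (intro has_field_derivative_at_within[OF holomorphic_derivI])
      qed (use that B in \<open>simp_all add: f_def\<close>)
      then show ?thesis by (simp add: f_def R_def gp_def algebra_simps power2_eq_square)
    qed
    then have "(\<Sum>i\<in>UNIV. (cmod (R z l $ i))\<^sup>2) \<le> (\<Sum>i\<in>UNIV. (B i * (cmod l)\<^sup>2)\<^sup>2)"
      by (intro sum_mono power_mono) auto
    also have "\<dots> = C * cmod l ^ 4"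
      by (simp add: C_def sum_distrib_right power_mult_distrib flip: power_mult)
    finally show ?thesis by (simp add: norm_vec_power2)
  qed
  \<comment> \<open>By \<open>1 \<le> K * \<rho>\<^sup>2\<close>, points \<open>w\<close> farther
    than \<open>\<rho>\<close> from \<open>g z\<close> contribute nothing positive; by
    \<open>r * B' \<le> \<rho>\<close>, the affine discs about the other points stay in
    \<open>U\<close>.\<close>
  have local: "uK K z \<le> (\<integral>t. uK K (z + of_real r * cis t) \<partial>angle) + K * C * r ^ 4"
    if K: "0 \<le> K" "1 \<le> K * \<rho>\<^sup>2" and zr: "cmod z + r \<le> 1" "0 < r" "r * B' \<le> \<rho>" for K z r
  proof (rule uK_least)
    fix w assume w: "w \<in> U"
    have zr1: "cmod (z + of_real r * l) \<le> 1" if "cmod l \<le> 1" for l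
    proof -
      have "cmod (of_real r * l) \<le> r" using that zr by (simp add: norm_mult mult_left_le)
      then show ?thesis using norm_triangle_ineq[of z "of_real r * l"] zr by linarith
    qed
    have z1: "cmod z \<le> 1" using zr by simp
    have sub_cont: "continuous_on (cball 0 1) (\<lambda>l. F (z + of_real r * l))"
      if "continuous_on (cball 0 1) F" for F :: "complex \<Rightarrow> 'b::topological_space"
      by (rule continuous_on_compose2[OF that]) (auto intro!: continuous_intros zr1)
    have int_uK: "integrable angle (\<lambda>t. uK K (z + of_real r * cis t))"
      by (rule integrable_angle_continuous) (intro sub_cont uK_cont K)
    show "u w - K * (dist w (g z))\<^sup>2 \<le> (\<integral>t. uK K (z + of_real r * cis t) \<partial>angle) + K * C * r ^ 4"
    proof (cases "dist w (g z) \<le> \<rho>")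
      case True
      define A where "A = w - g z"
      \<comment> \<open>The affine disc about \<open>w\<close> runs parallel to the tangent of
        \<open>g\<close> at \<open>z\<close>. Hence the linear terms cancel, and its difference from
        \<open>g\<close> at the corresponding point is \<open>A\<close> minus the Taylor
        remainder.\<close>
      define b where "b = of_real r *s gp z"
      \<comment> \<open>The cross term of the squared distance. It is holomorphic with
        \<open>q 0 = 0\<close>, so its real part has mean 0 over the circle.\<close>
      define q where "q = (\<lambda>l. \<Sum>i\<in>UNIV. cnj (A $ i) * R z (of_real r * l) $ i)"
      have disc: "w + k *s b \<in> U" if "cmod k \<le> 1" for k
      proof -
        have "norm b \<le> r * B'" using zr B'[of z] z1 by (simp add: b_def norm_vector_scalar_mult)
        then have "norm (k *s b) \<le> \<rho>"
          using that zr(3) mult_left_le_one_le[of "norm b" "cmod k"] by (simp add: norm_vector_scalar_mult)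
        moreover have "dist w0 w \<le> 2 * \<rho>"
          using dist_triangle[of w0 w "g z"] g_dist[OF z1] True by (simp add: dist_commute)
        ultimately show ?thesis
          using dist_triangle[of w0 "w + k *s b" w] by (simp add: U_def dist_norm)
      qed
      have meas_u: "(\<lambda>t. u (w + cis t *s b)) \<in> borel_measurable borel"
        using disc US by (intro usc_map_borel_measurable[OF usc] continuous_intros) auto
      have u_bound: "norm (u (w + cis t *s b)) \<le> 1" for t
        using bound[of "w + cis t *s b"] disc[of "cis t"] US by auto
      have "u w \<le> 1 / (2 * pi) * integral {0..2 * pi} (\<lambda>t. u (w + cis t *s b))"
        using psh disc US unfolding psh_vec_on_def by blast
      also have "\<dots> = (\<integral>t. u (w + cis t *s b) \<partial>angle)"
        using integral_angle_eq(2)[OF meas_u u_bound] by simp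
      also have "\<dots> \<le> (\<integral>t. uK K (z + of_real r * cis t) + (K * (norm A)\<^sup>2 + K * C * r ^ 4)
          - 2 * K * Re (q (cis t)) \<partial>angle)"
      proof (rule integral_mono)
        show "integrable angle (\<lambda>t. u (w + cis t *s b))"
          by (rule integrable_angle_bounded[OF meas_u u_bound])
        have "continuous_on (cball 0 1) q"
          unfolding q_def R_def
          by (intro continuous_intros sub_cont g_cont)
        then have "integrable angle (\<lambda>t. Re (q (cis t)))"
          by (intro integrable_angle_continuous continuous_intros)
        then show "integrable angle (\<lambda>t. uK K (z + of_real r * cis t) + (K * (norm A)\<^sup>2 + K * C * r ^ 4)
          - 2 * K * Re (q (cis t)))"
          using int_uK by simp
        fix t
        let ?l = "of_real r * cis t"
        have "(dist (w + cis t *s b) (g (z + ?l)))\<^sup>2 = (norm (A - R z ?l))\<^sup>2"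
          by (simp add: dist_norm A_def R_def b_def algebra_simps)
        also have "\<dots> = (norm A)\<^sup>2 - 2 * Re (q (cis t)) + (norm (R z ?l))\<^sup>2"
          unfolding norm_vec_power2 q_def
          by (simp only: vector_minus_component cmod_diff_power2 sum.distrib sum_subtractf Re_sum sum_distrib_left)
        also have "\<dots> \<le> (norm A)\<^sup>2 - 2 * Re (q (cis t)) + C * r ^ 4"
          using Taylor[OF z1, of ?l] zr1[of "cis t"] zr(2) by (simp add: norm_mult)
        finally have "K * (dist (w + cis t *s b) (g (z + ?l)))\<^sup>2 \<le> K * ((norm A)\<^sup>2 - 2 * Re (q (cis t)) + C * r ^ 4)"
          using K by (intro mult_left_mono)
        then show "u (w + cis t *s b) \<le> uK K (z + ?l) + (K * (norm A)\<^sup>2 + K * C * r ^ 4) - 2 * K * Re (q (cis t))"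
          using uK_upper[OF K(1) disc[of "cis t"], of "z + ?l"] by (simp add: algebra_simps)
      qed
      also have "\<dots> = (\<integral>t. uK K (z + of_real r * cis t) \<partial>angle) + (K * (norm A)\<^sup>2 + K * C * r ^ 4)"
      proof -
        have q_cont: "continuous_on (cball 0 1) q"
          unfolding q_def R_def
          by (intro continuous_intros sub_cont g_cont)
        have "q holomorphic_on ball 0 1"
        proof -
          have "(\<lambda>l. g (z + of_real r * l) $ i) holomorphic_on ball 0 1" for i
            using holomorphic_on_compose_gen[where f = "\<lambda>l. z + of_real r * l" and s = "ball 0 1", OF _ hol[of i]] T zr1
            by (force simp: o_def intro!: holomorphic_intros)
          then show ?thesis
            unfolding q_def R_def by (auto intro!: holomorphic_intros)
        qed
        from integral_angle_Re_holomorphic[OF q_cont this]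
        have "(\<integral>t. Re (q (cis t)) \<partial>angle) = 0" by (simp add: q_def R_def)
        moreover have "integrable angle (\<lambda>t. Re (q (cis t)))"
          by (intro integrable_angle_continuous continuous_intros q_cont)
        ultimately show ?thesis using int_uK by simp
      qed
      finally show ?thesis by (simp add: A_def dist_norm)
    next
      case False
      \<comment> \<open>Here the penalty is at least 1, which bounds \<open>u\<close>; the left side
        is at most 0 and the right side at least 0.\<close>
      then have "\<rho>\<^sup>2 \<le> (dist w (g z))\<^sup>2" using \<rho> by (intro power_mono) auto
      then have "1 \<le> K * (dist w (g z))\<^sup>2" using K by (meson mult_left_mono order_trans)
      moreover have "u w \<le> 1" using bound w US by auto
      moreover have "0 \<le> (\<integral>t. uK K (z + of_real r * cis t) \<partial>angle)"
        using uK_bound[OF K(1)] zr1 by (intro Bochner_Integration.integral_nonneg) auto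
      moreover have "0 \<le> K * C * r ^ 4" using K by (simp add: C_def sum_nonneg)
      ultimately show ?thesis by linarith
    qed
  qed
  have uK_submean: "uK K 0 \<le> (\<integral>t. uK K (cis t) \<partial>angle)" if K: "0 \<le> K" "1 \<le> K * \<rho>\<^sup>2" for K
  proof (rule circle_submean)
    show "usc_map (top_of_set (cball 0 1)) (uK K)"
      by (intro continuous_on_imp_usc_map uK_cont K)
    show "0 \<le> uK K z \<and> uK K z \<le> 1" if "cmod z \<le> 1" for z using uK_bound K that by simp
    fix \<rho>' :: real assume \<rho>': "0 < \<rho>'" "\<rho>' < 1"
    show "\<exists>\<delta>>0. \<exists>C. \<forall>z r. cmod z \<le> \<rho>' \<and> 0 < r \<and> r < \<delta> \<longrightarrow>
      uK K z \<le> (\<integral>t. uK K (z + of_real r * cis t) \<partial>angle) + C * r ^ 4"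
    proof (intro exI conjI allI impI)
      \<comment> \<open>The first bound keeps the circles in the closed unit disc, the second gives
        \<open>r * B' \<le> \<rho>\<close>; \<open>B' + 1\<close> avoids division by 0.\<close>
      show "0 < min (1 - \<rho>') (\<rho> / (B' + 1))" using \<rho>' \<rho> B'0 by simp
      fix z r assume zr: "cmod z \<le> \<rho>' \<and> 0 < r \<and> r < min (1 - \<rho>') (\<rho> / (B' + 1))"
      then have "r * (B' + 1) \<le> \<rho>" using B'0 by (simp add: pos_less_divide_eq)
      then have "r * B' \<le> \<rho>" using zr by (simp add: algebra_simps)
      then show "uK K z \<le> (\<integral>t. uK K (z + of_real r * cis t) \<partial>angle) + (K * C) * r ^ 4"
        using zr K by (intro local) auto
    qed
  qed
  have uK_limit: "(\<lambda>n. uK (real n) z) \<longlonglongrightarrow> u (g z)" if z: "cmod z \<le> 1" for z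
  proof (rule order_tendstoI)
    fix a assume "a < u (g z)"
    then show "eventually (\<lambda>n. a < uK (real n) z) sequentially"
      using uK_ge[OF _ z] by (intro always_eventually allI) (meson less_le_trans of_nat_0_le_iff)
  next
    fix a' assume a': "u (g z) < a'"
    then obtain a where a: "u (g z) < a" "a < a'" using dense by blast
    have gS: "g z \<in> S" using gU[OF z] US by auto
    obtain d where d: "0 < d" "\<And>w. w \<in> S \<Longrightarrow> dist w (g z) < d \<Longrightarrow> u w < a"
      using usc_map_dist_less[OF usc gS a(1)] by blast
    \<comment> \<open>From here on the penalty outside the ball of radius \<open>d\<close> about
      \<open>g z\<close> is at least 1, so only points with \<open>u w < a\<close> can contribute a
      positive value.\<close>
    have "eventually (\<lambda>n. 1 / d\<^sup>2 \<le> real n) sequentially"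
      using filterlim_real_sequentially by (simp add: filterlim_at_top)
    then show "eventually (\<lambda>n. uK (real n) z < a') sequentially"
    proof eventually_elim
      case (elim n)
      have "uK (real n) z \<le> a"
      proof (rule uK_least)
        fix w assume w: "w \<in> U"
        show "u w - real n * (dist w (g z))\<^sup>2 \<le> a"
        proof (cases "dist w (g z) < d")
          case True
          then have "u w < a" using d w US by auto
          moreover have "0 \<le> real n * (dist w (g z))\<^sup>2" by simp
          ultimately show ?thesis by linarith
        next
          case False
          then have "d\<^sup>2 \<le> (dist w (g z))\<^sup>2" using d by (intro power_mono) auto
          then have "real n * d\<^sup>2 \<le> real n * (dist w (g z))\<^sup>2" by (intro mult_left_mono) auto
          moreover have "1 \<le> real n * d\<^sup>2" using elim d by (simp add: pos_divide_le_eq)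
          moreover have "u w \<le> 1" using bound w US by auto
          moreover have "0 \<le> u (g z)" using bound gS by auto
          ultimately show ?thesis using a by linarith
        qed
      qed
      with a show ?case by simp
    qed
  qed
  have meas: "(\<lambda>t. u (g (cis t))) \<in> borel_measurable borel"
  proof (rule usc_map_borel_measurable[OF usc])
    show "continuous_on UNIV (\<lambda>t. g (cis t))"
      by (rule continuous_on_compose2[OF g_cont]) (auto intro!: continuous_intros)
    show "range (\<lambda>t. g (cis t)) \<subseteq> S" using gU US by auto
  qed
  have int: "integrable angle (\<lambda>t. uK (real n) (cis t))" for n
    by (intro integrable_angle_continuous uK_cont) auto
  have lim: "(\<lambda>n. \<integral>t. uK (real n) (cis t) \<partial>angle) \<longlonglongrightarrow> (\<integral>t. u (g (cis t)) \<partial>angle)"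
  proof (rule integral_dominated_convergence[where w = "\<lambda>_. 1"])
    show "(\<lambda>t. u (g (cis t))) \<in> borel_measurable angle"
      using meas by (simp cong: measurable_cong_sets)
    show "AE t in angle. (\<lambda>n. uK (real n) (cis t)) \<longlonglongrightarrow> u (g (cis t))"
      using uK_limit by simp
    show "AE t in angle. norm (uK (real n) (cis t)) \<le> 1" for n
      using uK_bound[of "real n" "cis t" for t] by (simp add: abs_le_iff)
  qed (use int in auto)
  have "eventually (\<lambda>n. 1 / \<rho>\<^sup>2 \<le> real n) sequentially"
    using filterlim_real_sequentially by (simp add: filterlim_at_top)
  then have "eventually (\<lambda>n. u (g 0) \<le> (\<integral>t. uK (real n) (cis t) \<partial>angle)) sequentially"
  proof eventually_elim
    case (elim n)
    then have "1 \<le> real n * \<rho>\<^sup>2" using \<rho> by (simp add: pos_divide_le_eq)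
    then show ?case using uK_submean[of "real n"] uK_ge[of "real n" 0] by simp
  qed
  then show ?thesis
    by (rule tendsto_lowerbound[OF lim]) simp
qed

section \<open>Differentials of holomorphic maps\<close>

text \<open>Complex linearity of the differential turns the real Frechet derivative into a complex
  derivative along each complex line. This gives access to one-variable function theory.\<close>

lemma holomorphic_vec_on_line_derivative:
  fixes G :: "complex^'n::finite \<Rightarrow> complex^'m::finite"
  assumes "holomorphic_vec_on G T" and "a + l *s b \<in> T"
  shows "((\<lambda>k. G (a + k *s b) $ i) has_field_derivative
    frechet_derivative G (at (a + l *s b)) b $ i) (at l)"
proof -
  obtain L where L: "(G has_derivative L) (at (a + l *s b))" "\<And>k v. L (k *s v) = k *s L v"
    using assms unfolding holomorphic_vec_on_def by blast
  have "bounded_linear (\<lambda>h::complex. h *s b)"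
    by (rule bounded_linear_intro[where K = "norm b"])
      (auto simp: norm_vector_scalar_mult vec_eq_iff algebra_simps)
  then have "((\<lambda>k. a + k *s b) has_derivative (\<lambda>h. h *s b)) (at l)"
    by (auto intro!: derivative_eq_intros bounded_linear_imp_has_derivative)
  from has_derivative_compose[OF this L(1)]
  have "((\<lambda>k. G (a + k *s b)) has_derivative (\<lambda>h. L (h *s b))) (at l)" .
  from bounded_linear.has_derivative[OF bounded_linear_vec_nth this, of i]
  have "((\<lambda>k. G (a + k *s b) $ i) has_derivative (\<lambda>h. L b $ i * h)) (at l)"
    by (simp add: L(2) mult.commute)
  then show ?thesis
    using frechet_derivative_at[OF L(1)] by (simp add: has_field_derivative_def)
qed

lemma holomorphic_vec_on_line_holomorphic:
  fixes G :: "complex^'n::finite \<Rightarrow> complex^'m::finite"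
  assumes "holomorphic_vec_on G T" and "\<And>l. l \<in> S \<Longrightarrow> a + l *s b \<in> T"
  shows "(\<lambda>l. G (a + l *s b) $ i) holomorphic_on S"
  unfolding holomorphic_on_def
  using assms holomorphic_vec_on_line_derivative field_differentiable_at_within field_differentiable_def
  by metis

lemma holomorphic_vec_on_imp_continuous_on:
  "holomorphic_vec_on G T \<Longrightarrow> continuous_on T G"
  unfolding holomorphic_vec_on_def
  by (meson continuous_at_imp_continuous_on has_derivative_continuous)

text \<open>Complex differentiability on an open set implies continuity of the differential, since by
  Cauchy's inequality the derivative along a complex line is controlled by values of the map.\<close>

lemma holomorphic_vec_on_tendsto_derivative:
  fixes G :: "complex^'n::finite \<Rightarrow> complex^'m::finite"
  assumes G: "holomorphic_vec_on G T" and x0: "x0 \<in> T"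
    and x: "(x \<longlongrightarrow> x0) F" and y: "(y \<longlongrightarrow> y0) F"
  shows "((\<lambda>t. frechet_derivative G (at (x t)) (y t)) \<longlongrightarrow> frechet_derivative G (at x0) y0) F"
proof (rule vec_tendstoI, rule tendstoI)
  fix i and e :: real assume e: "0 < e"
  have "open T" using G by (simp add: holomorphic_vec_on_def)
  then obtain \<rho> where \<rho>: "0 < \<rho>" "cball x0 \<rho> \<subseteq> T"
    using x0 open_contains_cball by blast
  \<comment> \<open>Directions near \<open>y0\<close> have norm at most \<open>norm y0 + 1\<close>,
    so discs of parameter radius \<open>r\<close> reach at most \<open>\<rho> / 2\<close> from their
    base points, which lie within \<open>\<rho> / 2\<close> of \<open>x0\<close>.\<close>
  define r where "r = \<rho> / (2 * (norm y0 + 1))"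
  have pos: "0 < norm y0 + 1" by (simp add: add_nonneg_pos)
  have r: "0 < r" "r * (norm y0 + 1) = \<rho> / 2"
    using \<rho> pos by (auto simp: r_def field_simps)
  have "uniformly_continuous_on (cball x0 \<rho>) G"
    using holomorphic_vec_on_imp_continuous_on[OF G] \<rho>
    by (intro compact_uniformly_continuous) (auto intro: continuous_on_subset)
  then obtain \<delta> where \<delta>: "0 < \<delta>" "\<And>z z'. z \<in> cball x0 \<rho> \<Longrightarrow> z' \<in> cball x0 \<rho> \<Longrightarrow> dist z' z < \<delta> \<Longrightarrow>
      dist (G z') (G z) < e * r / 2"
    unfolding uniformly_continuous_on_def using e r(1) by (metis divide_pos_pos mult_pos_pos zero_less_numeral)
  have "eventually (\<lambda>t. dist (x t) x0 < min (\<rho> / 2) (\<delta> / 2)) F"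
    using x \<rho> \<delta> by (intro tendstoD) auto
  moreover have "eventually (\<lambda>t. dist (y t) y0 < min 1 (\<delta> / (2 * r))) F"
    using y r \<delta> by (intro tendstoD) auto
  ultimately show "eventually (\<lambda>t. dist (frechet_derivative G (at (x t)) (y t) $ i)
      (frechet_derivative G (at x0) y0 $ i) < e) F"
  proof eventually_elim
    case (elim t)
    define \<phi> where "\<phi> = (\<lambda>a b l. G (a + l *s b) $ i)"
    have in_cball: "a + l *s b \<in> cball x0 \<rho>"
      if "dist a x0 < \<rho> / 2" "dist b y0 < 1" "cmod l \<le> r" for a b l
    proof -
      have "norm b \<le> norm y0 + 1"
        using that(2) norm_triangle_ineq[of y0 "b - y0"] by (simp add: dist_norm)
      then have "norm (l *s b) \<le> r * (norm y0 + 1)"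
        using that(3) r(1) by (simp add: norm_vector_scalar_mult mult_mono)
      then show ?thesis
        using that(1) dist_triangle[of x0 "a + l *s b" a] r by (simp add: dist_norm norm_minus_commute)
    qed
    have hol: "\<phi> a b holomorphic_on cball 0 r" if "dist a x0 < \<rho> / 2" "dist b y0 < 1" for a b
      unfolding \<phi>_def using in_cball[OF that] \<rho>
      by (intro holomorphic_vec_on_line_holomorphic[OF G]) auto
    have d0: "dist x0 x0 < \<rho> / 2" "dist y0 y0 < 1" using \<rho> by auto
    have dt: "dist (x t) x0 < \<rho> / 2" "dist (y t) y0 < 1" using elim by auto
    let ?\<psi> = "\<lambda>l. \<phi> (x t) (y t) l - \<phi> x0 y0 l"
    \<comment> \<open>The derivative at 0 of the difference of the two line restrictions is the
      difference of the differentials. Cauchy's inequality bounds it by \<open>e / 2\<close>,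
      uniform continuity of \<open>G\<close> giving \<open>e * r / 2\<close> on the circle.\<close>
    have "norm ((deriv ^^ 1) ?\<psi> 0) \<le> fact 1 * (e * r / 2) / r ^ 1"
    proof (rule Cauchy_inequality)
      have h: "?\<psi> holomorphic_on cball 0 r"
        using hol[OF d0] hol[OF dt] by (intro holomorphic_intros)
      then show "?\<psi> holomorphic_on ball 0 r"
        by (rule holomorphic_on_subset) auto
      show "continuous_on (cball 0 r) ?\<psi>"
        using h by (rule holomorphic_on_imp_continuous_on)
      fix l :: complex assume "cmod (0 - l) = r"
      then have l: "cmod l = r" by simp
      have "dist (x t + l *s y t) (x0 + l *s y0) = norm ((x t - x0) + l *s (y t - y0))"
        by (simp add: dist_norm algebra_simps vector_sub_rdistrib vec_eq_iff)
      also have "\<dots> \<le> dist (x t) x0 + r * dist (y t) y0"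
        using norm_triangle_ineq[of "x t - x0" "l *s (y t - y0)"] l
        unfolding norm_vector_scalar_mult by (simp only: dist_norm)
      also have "\<dots> < \<delta> / 2 + r * (\<delta> / (2 * r))"
        using elim r by (intro add_strict_mono mult_strict_left_mono) auto
      finally have "dist (x t + l *s y t) (x0 + l *s y0) < \<delta>" using r by simp
      from \<delta>(2)[OF in_cball[OF d0] in_cball[OF dt] this] l
      have "norm (G (x t + l *s y t) - G (x0 + l *s y0)) < e * r / 2"
        by (simp add: dist_norm)
      then have "cmod ((G (x t + l *s y t) - G (x0 + l *s y0)) $ i) \<le> e * r / 2"
        by (meson Finite_Cartesian_Product.norm_nth_le less_imp_le order_trans)
      then show "cmod (?\<psi> l) \<le> e * r / 2"
        by (simp add: \<phi>_def)
    qed (use r in auto)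
    moreover have "deriv ?\<psi> 0 = frechet_derivative G (at (x t)) (y t) $ i - frechet_derivative G (at x0) y0 $ i"
    proof (rule DERIV_imp_deriv)
      have "x t + 0 *s y t \<in> T" "x0 + 0 *s y0 \<in> T"
        using in_cball[OF dt, of 0] in_cball[OF d0, of 0] r \<rho> by auto
      from DERIV_diff[OF this[THEN holomorphic_vec_on_line_derivative[OF G]], of i i]
      show "(?\<psi> has_field_derivative
        frechet_derivative G (at (x t)) (y t) $ i - frechet_derivative G (at x0) y0 $ i) (at 0)"
        by (simp add: \<phi>_def)
    qed
    ultimately show ?case using r e by (simp add: dist_norm)
  qed
qed

section \<open>Curves and charts\<close>

lemma complex_manifold_chart_inv:
  assumes "complex_manifold M" and "c \<in> atlas M" and "x \<in> chart_dom c"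
  shows "chart_inv c (coords c x) = x"
proof -
  have "homeomorphic_map (subtopology (topol M) (chart_dom c)) (top_of_set (coords c ` chart_dom c)) (coords c)"
    and dom: "openin (topol M) (chart_dom c)"
    using assms(1,2) unfolding complex_manifold_def by blast+
  then have "inj_on (coords c) (topspace (subtopology (topol M) (chart_dom c)))"
    by (intro homeomorphic_imp_injective_map)
  then have "inj_on (coords c) (chart_dom c)"
    by (simp only: topspace_subtopology_subset[OF openin_subset[OF dom]])
  then show ?thesis using assms(3) by (rule inv_into_f_f)
qed

lemma complex_manifold_chart_exists:
  assumes "complex_manifold M" and "x \<in> points M"
  obtains c where "c \<in> atlas M" and "x \<in> chart_dom c"
proof -
  have "(\<Union>c\<in>atlas M. chart_dom c) = points M"
    using assms(1) unfolding complex_manifold_def by (elim conjE)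
  then show ?thesis using assms(2) that by (metis UN_E)
qed

lemma curves_compose_chart_derivative:
  fixes M :: "('a, 'n::finite) cmanifold" and N :: "('b, 'm::finite) cmanifold"
  assumes M: "complex_manifold M" and f: "holomorphic_mapping M N f"
    and \<gamma>: "continuous_map (top_of_set {-\<epsilon><..<\<epsilon>}) (topol M) \<gamma>" and t: "t \<in> {-\<epsilon><..<\<epsilon>}"
    and c: "c \<in> atlas M" "\<gamma> t \<in> chart_dom c" and d: "d \<in> atlas N" "f (\<gamma> t) \<in> chart_dom d"
    and \<eta>: "((coords c \<circ> \<gamma>) has_vector_derivative \<eta>) (at t)"
  shows "((coords d \<circ> (f \<circ> \<gamma>)) has_vector_derivative
    frechet_derivative (coords d \<circ> f \<circ> chart_inv c) (at (coords c (\<gamma> t))) \<eta>) (at t)"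
proof -
  let ?G = "coords d \<circ> f \<circ> chart_inv c"
  have "holomorphic_vec_on ?G (coords c ` {x \<in> chart_dom c. f x \<in> chart_dom d})"
    using f c d unfolding holomorphic_mapping_def by blast
  then obtain L where L: "(?G has_derivative L) (at (coords c (\<gamma> t)))"
    unfolding holomorphic_vec_on_def using c d by blast
  then have "linear L" by (rule has_derivative_linear)
  have \<eta>': "((coords c \<circ> \<gamma>) has_derivative (\<lambda>h. h *\<^sub>R \<eta>)) (at t)"
    using \<eta> by (simp only: has_vector_derivative_def)
  have "(?G has_derivative L) (at ((coords c \<circ> \<gamma>) t))"
    using L by (simp only: o_apply)
  from has_derivative_compose[OF \<eta>' this]
  have D: "((\<lambda>s. ?G ((coords c \<circ> \<gamma>) s)) has_vector_derivative L \<eta>) (at t)"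
    by (simp add: has_vector_derivative_def linear_cmul[OF \<open>linear L\<close>])
  \<comment> \<open>The factorization through the chart \<open>c\<close> is valid only while
    \<open>\<gamma>\<close> stays in its domain; these times form an open set, which suffices for
    the derivative at \<open>t\<close>.\<close>
  have "openin (topol M) (chart_dom c)"
    using M c unfolding complex_manifold_def by blast
  from openin_continuous_map_preimage[OF \<gamma> this]
  have "open {s \<in> {-\<epsilon><..<\<epsilon>}. \<gamma> s \<in> chart_dom c}"
    by (simp add: openin_open_eq)
  from has_vector_derivative_transform_within_open[OF D this] show ?thesis
    using t c(2) frechet_derivative_at[OF L] complex_manifold_chart_inv[OF M c(1)] by auto
qed

lemma curves_push_forward:
  fixes M :: "('a, 'n::finite) cmanifold" and N :: "('b, 'm::finite) cmanifold"
  assumes M: "complex_manifold M" and N: "complex_manifold N" and f: "holomorphic_mapping M N f"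
    and \<gamma>: "\<gamma> \<in> curves M p (tangent_J \<xi>)"
  shows "f \<circ> \<gamma> \<in> curves N (f p) (tangent_J (tangent_map M N f p \<xi>))"
proof -
  obtain \<epsilon> where \<epsilon>: "0 < \<epsilon>" and cont: "continuous_map (top_of_set {-\<epsilon><..<\<epsilon>}) (topol M) \<gamma>"
    and C1: "\<And>c. c \<in> atlas M \<Longrightarrow> (coords c \<circ> \<gamma>) C1_differentiable_on {t \<in> {-\<epsilon><..<\<epsilon>}. \<gamma> t \<in> chart_dom c}"
    and \<gamma>0: "\<gamma> 0 = p"
    and deriv: "\<And>c. c \<in> charts_at M p \<Longrightarrow> ((coords c \<circ> \<gamma>) has_vector_derivative tangent_J \<xi> c) (at 0)"
    using \<gamma> unfolding curves_def by blast
  have cont_f: "continuous_map (topol M) (topol N) f"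
    using f by (simp add: holomorphic_mapping_def)
  have cont': "continuous_map (top_of_set {-\<epsilon><..<\<epsilon>}) (topol N) (f \<circ> \<gamma>)"
    using cont cont_f by (rule continuous_map_compose)
  have \<gamma>_points: "\<gamma> t \<in> points M" if "t \<in> {-\<epsilon><..<\<epsilon>}" for t
    using cont that by (auto simp: continuous_map_def Pi_iff)
  have open_M: "open {t \<in> {-\<epsilon><..<\<epsilon>}. \<gamma> t \<in> chart_dom c}" if "c \<in> atlas M" for c
  proof -
    have "openin (topol M) (chart_dom c)" using M that unfolding complex_manifold_def by blast
    from openin_continuous_map_preimage[OF cont this] show ?thesis by (simp add: openin_open_eq)
  qed
  have open_N: "open {t \<in> {-\<epsilon><..<\<epsilon>}. (f \<circ> \<gamma>) t \<in> chart_dom d}" if "d \<in> atlas N" for d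
  proof -
    have "openin (topol N) (chart_dom d)" using N that unfolding complex_manifold_def by blast
    from openin_continuous_map_preimage[OF cont' this] show ?thesis by (simp add: openin_open_eq)
  qed
  have C1': "(coords d \<circ> (f \<circ> \<gamma>)) C1_differentiable_on {t \<in> {-\<epsilon><..<\<epsilon>}. (f \<circ> \<gamma>) t \<in> chart_dom d}"
    (is "_ C1_differentiable_on ?S") if d: "d \<in> atlas N" for d
  proof -
    have at_point: "(coords d \<circ> (f \<circ> \<gamma>)) differentiable at t \<and>
        isCont (\<lambda>t. vector_derivative (coords d \<circ> (f \<circ> \<gamma>)) (at t)) t" if t: "t \<in> ?S" for t
    proof -
      obtain c where c: "c \<in> atlas M" "\<gamma> t \<in> chart_dom c"
        using complex_manifold_chart_exists[OF M] \<gamma>_points t by blast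
      let ?I = "{t \<in> {-\<epsilon><..<\<epsilon>}. \<gamma> t \<in> chart_dom c}"
      let ?G = "coords d \<circ> f \<circ> chart_inv c"
      have C1c: "\<And>s. s \<in> ?I \<Longrightarrow> (coords c \<circ> \<gamma>) differentiable at s"
        "continuous_on ?I (\<lambda>s. vector_derivative (coords c \<circ> \<gamma>) (at s))"
        using C1[OF c(1)] unfolding C1_differentiable_on_eq by auto
      \<comment> \<open>The formula is needed on a whole neighbourhood of \<open>t\<close>:
        continuity of the velocity follows by letting both base point and direction converge in
        it.\<close>
      have D: "((coords d \<circ> (f \<circ> \<gamma>)) has_vector_derivative
          frechet_derivative ?G (at (coords c (\<gamma> s))) (vector_derivative (coords c \<circ> \<gamma>) (at s))) (at s)"
        if "s \<in> ?S \<inter> ?I" for s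
        using that c d C1c(1)[of s] vector_derivative_works[of "coords c \<circ> \<gamma>" "at s"]
        by (intro curves_compose_chart_derivative[OF M f cont]) auto
      have tI: "t \<in> ?S \<inter> ?I" using t c by auto
      have open_SI: "open (?S \<inter> ?I)" using open_M[OF c(1)] open_N[OF d] by blast
      have hol: "holomorphic_vec_on ?G (coords c ` {x \<in> chart_dom c. f x \<in> chart_dom d})"
        using f c d unfolding holomorphic_mapping_def by blast
      have "((\<lambda>s. coords c (\<gamma> s)) \<longlongrightarrow> coords c (\<gamma> t)) (at t)"
        using differentiable_imp_continuous_within[OF C1c(1)[of t]] tI
        by (auto simp: continuous_within o_def)
      moreover have "((\<lambda>s. vector_derivative (coords c \<circ> \<gamma>) (at s)) \<longlongrightarrow> vector_derivative (coords c \<circ> \<gamma>) (at t)) (at t)"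
        using C1c(2) tI open_M[OF c(1)] by (simp add: continuous_on_eq_continuous_at isCont_def)
      ultimately have "((\<lambda>s. frechet_derivative ?G (at (coords c (\<gamma> s))) (vector_derivative (coords c \<circ> \<gamma>) (at s)))
          \<longlongrightarrow> frechet_derivative ?G (at (coords c (\<gamma> t))) (vector_derivative (coords c \<circ> \<gamma>) (at t))) (at t)"
        using t c by (intro holomorphic_vec_on_tendsto_derivative[OF hol]) auto
      then have "((\<lambda>s. vector_derivative (coords d \<circ> (f \<circ> \<gamma>)) (at s))
          \<longlongrightarrow> vector_derivative (coords d \<circ> (f \<circ> \<gamma>)) (at t)) (at t)"
        unfolding vector_derivative_at[OF D[OF tI]]
        by (rule Lim_transform_within_open[OF _ open_SI tI]) (simp only: vector_derivative_at[OF D])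
      moreover have "(coords d \<circ> (f \<circ> \<gamma>)) differentiable at t"
        using D[OF tI] by (rule differentiableI_vector)
      ultimately show ?thesis unfolding isCont_def by (rule conjI[rotated])
    qed
    then show ?thesis
      unfolding C1_differentiable_on_eq by (auto intro: continuous_at_imp_continuous_on)
  qed
  have "((coords d \<circ> (f \<circ> \<gamma>)) has_vector_derivative tangent_J (tangent_map M N f p \<xi>) d) (at 0)"
    if d: "d \<in> charts_at N (f p)" for d
  proof -
    \<comment> \<open>The very chart chosen inside \<open>tangent_map\<close>, so that the velocity
      matches its definition without a change of charts.\<close>
    define c where "c = (SOME c. c \<in> charts_at M p)"
    have "p \<in> points M" using \<gamma>_points[of 0] \<gamma>0 \<epsilon> by auto
    then obtain c' where "c' \<in> atlas M" "p \<in> chart_dom c'"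
      using complex_manifold_chart_exists[OF M] by metis
    then have "c' \<in> charts_at M p" by (simp add: charts_at_def)
    then have c: "c \<in> charts_at M p" unfolding c_def by (rule someI)
    let ?G = "coords d \<circ> f \<circ> chart_inv c"
    have d': "d \<in> atlas N" "f p \<in> chart_dom d" and c': "c \<in> atlas M" "p \<in> chart_dom c"
      using c d by (auto simp: charts_at_def)
    have "((coords d \<circ> (f \<circ> \<gamma>)) has_vector_derivative
        frechet_derivative ?G (at (coords c (\<gamma> 0))) (tangent_J \<xi> c)) (at 0)"
      using c' d' \<gamma>0 \<epsilon> deriv[OF c] by (intro curves_compose_chart_derivative[OF M f cont]) auto
    \<comment> \<open>With \<open>k = \<i>\<close> this says that the differential of
      \<open>f\<close> commutes with \<open>J\<close>.\<close>
    moreover have "frechet_derivative ?G (at (coords c p)) (k *s v) = k *s frechet_derivative ?G (at (coords c p)) v" for k v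
    proof -
      have "holomorphic_vec_on ?G (coords c ` {x \<in> chart_dom c. f x \<in> chart_dom d})"
        using f c' d' unfolding holomorphic_mapping_def by blast
      then obtain L where "(?G has_derivative L) (at (coords c p))" "\<And>k v. L (k *s v) = k *s L v"
        unfolding holomorphic_vec_on_def using c' d' by blast
      then show ?thesis using frechet_derivative_at by metis
    qed
    ultimately show ?thesis
      using d by (simp add: \<gamma>0 tangent_J_def tangent_map_def Let_def flip: c_def)
  qed
  then show ?thesis
    unfolding curves_def using \<epsilon> cont' C1' \<gamma>0 by auto
qed

section \<open>Pulling back plurisubharmonic functions\<close>

text \<open>Near each point \<open>u\<close> is a plurisubharmonic function composed with a
  holomorphic map, so \<open>submean_compose\<close> handles small discs in a complex line. A
  Lebesgue number makes the admissible radius uniform, and \<open>circle_submean\<close> passes to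
  large discs.\<close>

lemma psh_vec_on_local:
  fixes u :: "complex^'n::finite \<Rightarrow> real"
  assumes S: "open S" and bound: "\<And>z. z \<in> S \<Longrightarrow> 0 \<le> u z \<and> u z \<le> 1"
    and local: "\<And>z. z \<in> S \<Longrightarrow> \<exists>T S' (w :: complex^'m::finite \<Rightarrow> real) G. z \<in> T \<and> T \<subseteq> S \<and>
      holomorphic_vec_on G T \<and> G ` T \<subseteq> S' \<and> open S' \<and> psh_vec_on w S' \<and>
      (\<forall>y\<in>S'. 0 \<le> w y \<and> w y \<le> 1) \<and> (\<forall>x\<in>T. u x = w (G x))"
  shows "psh_vec_on u S"
proof -
  have "open {z \<in> S. u z < a}" for a
  proof (subst open_subopen, intro ballI)
    fix z assume z: "z \<in> {z \<in> S. u z < a}"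
    then obtain T S' and w :: "complex^'m \<Rightarrow> real" and G where *: "z \<in> T" "T \<subseteq> S"
      "holomorphic_vec_on G T" "G ` T \<subseteq> S'" "psh_vec_on w S'" "\<forall>x\<in>T. u x = w (G x)"
      using local[of z] by blast
    have "open T" using *(3) by (simp add: holomorphic_vec_on_def)
    have "usc_map (top_of_set T) (w \<circ> G)"
      using * holomorphic_vec_on_imp_continuous_on[OF *(3)]
      by (intro usc_map_compose[of "top_of_set S'"]) (auto simp: psh_vec_on_def)
    then have "openin (top_of_set T) {x \<in> T. w (G x) < a}"
      by (simp add: usc_map_def)
    then have "open {x \<in> T. w (G x) < a}"
      using \<open>open T\<close> by (simp add: openin_open_eq)
    then show "\<exists>O'. open O' \<and> z \<in> O' \<and> O' \<subseteq> {z \<in> S. u z < a}"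
      using * z by (intro exI[of _ "{x \<in> T. w (G x) < a}"]) auto
  qed
  then have usc: "usc_map (top_of_set S) u"
    using S by (simp add: usc_map_def openin_open_eq)
  have "(\<lambda>t. u (a + cis t *s b)) absolutely_integrable_on {0..2 * pi} \<and>
      u a \<le> 1 / (2 * pi) * integral {0..2 * pi} (\<lambda>t. u (a + cis t *s b))"
    if disc: "\<forall>k. cmod k \<le> 1 \<longrightarrow> a + k *s b \<in> S" for a b
  proof -
    define v where "v = (\<lambda>l. u (a + l *s b))"
    have line_cont: "continuous_on X (\<lambda>l. a + l *s b)" for X
      by (intro continuous_intros)
    have usc_v: "usc_map (top_of_set (cball 0 1)) v"
    proof -
      have "usc_map (top_of_set (cball 0 1)) (u \<circ> (\<lambda>l. a + l *s b))"
        using disc line_cont by (intro usc_map_compose[OF usc]) auto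
      then show ?thesis by (simp add: v_def o_def)
    qed
    have v_bound: "0 \<le> v z \<and> v z \<le> 1" if "cmod z \<le> 1" for z
      unfolding v_def using bound disc that by blast
    \<comment> \<open>The open sets of parameters on which the sub-mean value inequality holds for
      every closed disc they contain.\<close>
    define \<G> where "\<G> = {X. open X \<and> (\<forall>z r. 0 < r \<and> cball z r \<subseteq> X \<longrightarrow>
        v z \<le> (\<integral>t. v (z + of_real r * cis t) \<partial>angle))}"
    have cover: "cball 0 1 \<subseteq> \<Union>\<G>"
    proof
      fix l0 :: complex assume "l0 \<in> cball 0 1"
      then have l0: "a + l0 *s b \<in> S" using disc by simp
      obtain T S' and w :: "complex^'m \<Rightarrow> real" and G where *: "a + l0 *s b \<in> T" "T \<subseteq> S"
        "holomorphic_vec_on G T" "G ` T \<subseteq> S'" "open S'" "psh_vec_on w S'"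
        "\<forall>y\<in>S'. 0 \<le> w y \<and> w y \<le> 1" "\<forall>x\<in>T. u x = w (G x)"
        using local[OF l0] by blast
      have "open T" using *(3) by (simp add: holomorphic_vec_on_def)
      define w0 where "w0 = G (a + l0 *s b)"
      have "w0 \<in> S'" using * by (auto simp: w0_def)
      then obtain \<rho>' where \<rho>': "0 < \<rho>'" "cball w0 \<rho>' \<subseteq> S'"
        using \<open>open S'\<close> open_contains_cball by blast
      define \<rho> where "\<rho> = \<rho>' / 3"
      have \<rho>: "0 < \<rho>" "cball w0 (3 * \<rho>) \<subseteq> S'" using \<rho>' by (auto simp: \<rho>_def)
      \<comment> \<open>The parameters near \<open>l0\<close> whose image under \<open>G\<close>
        lies in the small ball required by \<open>submean_compose\<close>.\<close>
      define X where "X = {l. a + l *s b \<in> T \<inter> G -` ball w0 \<rho>}"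
      have "open (T \<inter> G -` ball w0 \<rho>)"
        using holomorphic_vec_on_imp_continuous_on[OF *(3)] \<open>open T\<close>
        by (intro continuous_open_preimage) auto
      then have "open ((\<lambda>l. a + l *s b) -` (T \<inter> G -` ball w0 \<rho>))"
        using line_cont[of UNIV] by (intro open_vimage) auto
      then have "open X" by (simp add: X_def vimage_def)
      have "v z \<le> (\<integral>t. v (z + of_real r * cis t) \<partial>angle)" if zr: "0 < r" "cball z r \<subseteq> X" for z r
      proof -
        define g where "g = (\<lambda>l. G (a + (z + of_real r * l) *s b))"
        have in_X: "z + of_real r * l \<in> X" if "cmod l \<le> 1" for l
          using that zr by (intro subsetD[OF zr(2)]) (auto simp: dist_norm norm_mult mult_left_le)
        have line: "a + (z + of_real r * l) *s b = (a + z *s b) + l *s (of_real r *s b)" for l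
          by (simp add: vec_eq_iff algebra_simps)
        have "w (g 0) \<le> (\<integral>t. w (g (cis t)) \<partial>angle)"
        proof (rule submean_compose[OF *(6)])
          show "open {l. z + of_real r * l \<in> X}"
          proof -
            have "open ((\<lambda>l. z + of_real r * l) -` X)"
              using \<open>open X\<close> by (intro open_vimage continuous_intros)
            then show ?thesis by (simp add: vimage_def)
          qed
          show "cball 0 1 \<subseteq> {l. z + of_real r * l \<in> X}" using in_X by auto
          show "(\<lambda>l. g l $ i) holomorphic_on {l. z + of_real r * l \<in> X}" for i
            unfolding g_def line
          proof (rule holomorphic_vec_on_line_holomorphic[OF *(3)])
            fix l assume "l \<in> {l. z + of_real r * l \<in> X}"
            then have "a + (z + of_real r * l) *s b \<in> T" by (simp only: X_def mem_Collect_eq Int_iff)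
            then show "(a + z *s b) + l *s (of_real r *s b) \<in> T" by (simp only: line)
          qed
          show "g ` cball 0 1 \<subseteq> cball w0 \<rho>"
            using in_X by (force simp: g_def X_def)
        qed (use * \<rho> in auto)
        moreover have "v (z + of_real r * l) = w (g l)" if "cmod l \<le> 1" for l
          using in_X[OF that] * by (simp add: v_def g_def X_def)
        from this[of 0] this[of "cis t" for t] have "v z = w (g 0)" "\<And>t. v (z + of_real r * cis t) = w (g (cis t))"
          by simp_all
        ultimately show ?thesis by simp
      qed
      then have "X \<in> \<G>" using \<open>open X\<close> by (simp add: \<G>_def)
      moreover have "l0 \<in> X" using * \<rho> by (simp add: X_def w0_def)
      ultimately show "l0 \<in> \<Union>\<G>" by blast
    qed
    have "open X" if "X \<in> \<G>" for X
      using that by (simp only: \<G>_def mem_Collect_eq)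
    \<comment> \<open>A Lebesgue number of the cover; it serves as \<open>\<delta>\<close> for every
      \<open>\<rho>\<close>, with error constant 0.\<close>
    then obtain \<epsilon> where \<epsilon>: "0 < \<epsilon>" "\<And>z. z \<in> cball 0 1 \<Longrightarrow> \<exists>X\<in>\<G>. ball z \<epsilon> \<subseteq> X"
      using Heine_Borel_lemma[OF compact_cball cover] by metis
    have submean: "v 0 \<le> (\<integral>t. v (cis t) \<partial>angle)"
    proof (rule circle_submean[OF usc_v v_bound])
      fix \<rho> :: real assume "\<rho> < 1"
      have "v z \<le> (\<integral>t. v (z + of_real r * cis t) \<partial>angle) + 0 * r ^ 4"
        if zr: "cmod z \<le> \<rho> \<and> 0 < r \<and> r < \<epsilon>" for z r
      proof -
        have "z \<in> cball 0 1" using zr \<open>\<rho> < 1\<close> by simp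
        then obtain X where X: "X \<in> \<G>" "ball z \<epsilon> \<subseteq> X" using \<epsilon>(2) by blast
        have "cball z r \<subseteq> X" using zr X(2) by (auto simp: subset_iff)
        then show ?thesis using X(1) zr by (simp add: \<G>_def)
      qed
      then show "\<exists>\<delta>>0. \<exists>C. \<forall>z r. cmod z \<le> \<rho> \<and> 0 < r \<and> r < \<delta> \<longrightarrow>
          v z \<le> (\<integral>t. v (z + of_real r * cis t) \<partial>angle) + C * r ^ 4"
        using \<epsilon>(1) by blast
    qed
    have "(\<lambda>t. v (cis t)) \<in> borel_measurable borel"
      by (intro usc_map_borel_measurable[OF usc_v] continuous_intros) auto
    moreover have "norm (v (cis t)) \<le> 1" for t using v_bound[of "cis t"] by simp
    ultimately have "(\<lambda>t. v (cis t)) absolutely_integrable_on {0..2 * pi}"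
      and "(\<integral>t. v (cis t) \<partial>angle) = 1 / (2 * pi) * integral {0..2 * pi} (\<lambda>t. v (cis t))"
      by (rule integral_angle_eq)+
    with submean show ?thesis by (simp add: v_def)
  qed
  with usc show ?thesis unfolding psh_vec_on_def by blast
qed

lemma class_U_pullback:
  fixes M :: "('a, 'n::finite) cmanifold" and N :: "('b, 'm::finite) cmanifold"
  assumes M: "complex_manifold M" and N: "complex_manifold N" and f: "holomorphic_mapping M N f"
    and VW: "f ` V \<subseteq> W" and u: "u \<in> class_U W N"
  shows "u \<circ> f \<in> class_U V M"
proof -
  have f_points: "f x \<in> points N" if "x \<in> points M" for x
    using f that by (auto simp: holomorphic_mapping_def continuous_map_def Pi_iff)
  have u_bound: "0 \<le> u y \<and> u y < pi / 4" if "y \<in> points N" for y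
    using u that by (simp add: class_U_def)
  \<comment> \<open>Since \<open>pi < 4\<close>, the functions of the class satisfy the
    normalization by 1 used in the analytic lemmas.\<close>
  have u_bound1: "0 \<le> u y \<and> u y \<le> 1" if "y \<in> points N" for y
    using u_bound[OF that] pi_less_4 by simp
  have chart_points: "x \<in> points M" if "c \<in> atlas M" "x \<in> chart_dom c" for c x
  proof -
    have "(\<Union>c\<in>atlas M. chart_dom c) = points M"
      using M unfolding complex_manifold_def by (elim conjE)
    then show ?thesis using that by blast
  qed
  have "psh_vec_on ((u \<circ> f) \<circ> chart_inv c) (coords c ` chart_dom c)" if c: "c \<in> atlas M" for c
  proof (rule psh_vec_on_local)
    show "open (coords c ` chart_dom c)"
      using M c unfolding complex_manifold_def by blast
    have inv_c: "chart_inv c (coords c x) = x" if "x \<in> chart_dom c" for x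
      using M c that by (rule complex_manifold_chart_inv)
    show "0 \<le> ((u \<circ> f) \<circ> chart_inv c) z \<and> ((u \<circ> f) \<circ> chart_inv c) z \<le> 1"
      if "z \<in> coords c ` chart_dom c" for z
    proof -
      obtain x where x: "x \<in> chart_dom c" "z = coords c x" using \<open>z \<in> _\<close> by blast
      then show ?thesis
        using u_bound1[OF f_points[OF chart_points[OF c x(1)]]] inv_c[OF x(1)] by (simp only: o_apply)
    qed
    fix z assume "z \<in> coords c ` chart_dom c"
    then obtain x where x: "x \<in> chart_dom c" "z = coords c x" by blast
    obtain d where d: "d \<in> atlas N" "f x \<in> chart_dom d"
      using complex_manifold_chart_exists[OF N f_points[OF chart_points[OF c x(1)]]] by metis
    have inv_d: "chart_inv d (coords d y) = y" if "y \<in> chart_dom d" for y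
      using N d(1) that by (rule complex_manifold_chart_inv)
    have d_points: "chart_dom d \<subseteq> points N"
    proof -
      have "(\<Union>c\<in>atlas N. chart_dom c) = points N"
        using N unfolding complex_manifold_def by (elim conjE)
      then show ?thesis using d(1) by blast
    qed
    let ?T = "coords c ` {x \<in> chart_dom c. f x \<in> chart_dom d}"
    let ?G = "coords d \<circ> f \<circ> chart_inv c"
    have T: "z \<in> ?T" "?T \<subseteq> coords c ` chart_dom c" using x d by blast+
    have G: "holomorphic_vec_on ?G ?T"
      using f c d(1) unfolding holomorphic_mapping_def by blast
    have G_apply: "?G (coords c y) = coords d (f y)" if "y \<in> chart_dom c" for y
      by (simp only: o_apply inv_c[OF that])
    have GT: "?G ` ?T \<subseteq> coords d ` chart_dom d"
    proof
      fix k assume "k \<in> ?G ` ?T"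
      then obtain y where y: "y \<in> chart_dom c" "f y \<in> chart_dom d" "k = ?G (coords c y)" by blast
      then show "k \<in> coords d ` chart_dom d" unfolding G_apply[OF y(1)] by blast
    qed
    have op: "open (coords d ` chart_dom d)"
      using N d(1) unfolding complex_manifold_def by blast
    have psh: "psh_vec_on (u \<circ> chart_inv d) (coords d ` chart_dom d)"
      using u d(1) by (simp add: class_U_def plurisubharmonic_def)
    have bd: "\<forall>y\<in>coords d ` chart_dom d. 0 \<le> (u \<circ> chart_inv d) y \<and> (u \<circ> chart_inv d) y \<le> 1"
    proof
      fix k assume "k \<in> coords d ` chart_dom d"
      then obtain y where y: "y \<in> chart_dom d" "k = coords d y" by blast
      then show "0 \<le> (u \<circ> chart_inv d) k \<and> (u \<circ> chart_inv d) k \<le> 1"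
        using u_bound1[OF subsetD[OF d_points y(1)]] inv_d[OF y(1)] by (simp only: o_apply)
    qed
    have eq: "\<forall>k\<in>?T. ((u \<circ> f) \<circ> chart_inv c) k = (u \<circ> chart_inv d) (?G k)"
    proof
      fix k assume "k \<in> ?T"
      then obtain y where y: "y \<in> chart_dom c" "f y \<in> chart_dom d" "k = coords c y" by blast
      then show "((u \<circ> f) \<circ> chart_inv c) k = (u \<circ> chart_inv d) (?G k)"
        by (simp only: o_apply inv_c[OF y(1)] inv_d[OF y(2)])
    qed
    show "\<exists>T S' (w :: complex^'m \<Rightarrow> real) G. z \<in> T \<and> T \<subseteq> coords c ` chart_dom c \<and>
      holomorphic_vec_on G T \<and> G ` T \<subseteq> S' \<and> open S' \<and> psh_vec_on w S' \<and>
      (\<forall>y\<in>S'. 0 \<le> w y \<and> w y \<le> 1) \<and> (\<forall>x\<in>T. ((u \<circ> f) \<circ> chart_inv c) x = w (G x))"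
      by (rule exI[of _ ?T], rule exI[of _ "coords d ` chart_dom d"], rule exI[of _ "u \<circ> chart_inv d"],
          rule exI[of _ ?G]) (intro conjI T G GT op psh bd eq)
  qed
  then have "plurisubharmonic M (u \<circ> f)"
    unfolding plurisubharmonic_def by blast
  moreover have "\<forall>p\<in>V. (u \<circ> f) p = 0"
    using u VW by (auto simp: class_U_def)
  ultimately show ?thesis
    using u_bound f_points by (simp add: class_U_def)
qed

theorem theorem3p3:
  fixes M :: "('a, 'n::finite) cmanifold" and V :: "'a set"
    and N :: "('b, 'm::finite) cmanifold" and W :: "'b set"
    and f :: "'a \<Rightarrow> 'b" and p :: 'a and \<xi> :: "('a, 'n) tangent"
  assumes "analytic_pair V M" and "analytic_pair W N"
    and "holomorphic_mapping M N f" and "f ` V \<subseteq> W"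
    and "p \<in> V" and "\<xi> \<in> submanifold_tangent_space V M p"
  shows "pair_E W N (f p) (tangent_map M N f p \<xi>) \<le> pair_E V M p \<xi>"
  unfolding pair_E_def
proof (rule SUP_mono)
  have M: "complex_manifold M" and N: "complex_manifold N"
    using assms(1,2) by (simp_all add: analytic_pair_def)
  fix u assume u: "u \<in> class_U W N"
  have "function_E u N (f p) (tangent_map M N f p \<xi>) \<le> function_E (u \<circ> f) M p \<xi>"
    unfolding function_E_def
  \<comment> \<open>Each curve on \<open>M\<close> has an image curve on \<open>N\<close> with the
    same quotients, so the infimum on \<open>N\<close> is at most that on \<open>M\<close>.\<close>
  proof (rule INF_mono)
    fix \<gamma> assume "\<gamma> \<in> curves M p (tangent_J \<xi>)"
    then have "f \<circ> \<gamma> \<in> curves N (f p) (tangent_J (tangent_map M N f p \<xi>))"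
      by (rule curves_push_forward[OF M N assms(3)])
    then show "\<exists>\<gamma>'\<in>curves N (f p) (tangent_J (tangent_map M N f p \<xi>)).
        Limsup (at_right 0) (\<lambda>t. ereal (u (\<gamma>' t) / t)) \<le> Limsup (at_right 0) (\<lambda>t. ereal ((u \<circ> f) (\<gamma> t) / t))"
      by (intro bexI[of _ "f \<circ> \<gamma>"]) simp_all
  qed
  then show "\<exists>u'\<in>class_U V M. function_E u N (f p) (tangent_map M N f p \<xi>) \<le> function_E u' M p \<xi>"
    using class_U_pullback[OF M N assms(3,4) u] by blast
qed

end
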